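(* Let $q>3$ be a prime. Every (left) brace of order $4q$ is isomorphic to exactly one of the following braces (pairwise non-isomorphic): (1) in every case: the two braces $T^{2,2,q}_{\pm1,1}$; the two braces $T^{4,q}_{\pm1}$; the two braces $B^{2,2,q}_{\pm1}$; the three braces $B^{4,q}_{1,1}$, $B^{4,q}_{1,-1}$, $B^{4,q}_{-1,1}$; (2) additionally, if $4\mid q-1$: $T^{4,q}_{\omega}$ and $B^{2,2,q}_{\omega}$, where $\omega\in\mathbb{Z}_q^\times$ is a fixed primitive $4$-th root of unity.
   Context: $\mathbb{Z}_n=\mathbb{Z}/n\mathbb{Z}$. Elements of $\mathbb{Z}_4$ are written as binary strings: for $x,y\in\{0,1\}$, $\underline{xy}=2x+y\in\mathbb{Z}_4$ (so $\underline{00}=0$, $\underline{01}=1$, $\underline{10}=2$, $\underline{11}=3$). A (left) brace is a (here finite) abelian group $(A,+)$ with a binary operation $\cdot$ such that for all $a,b,c\in A$: $a\cdot(b+c)=a\cdot b+a\cdot c$; $(a\cdot b+a+b)\cdot c=a\cdot(b\cdot c)+a\cdot c+b\cdot c$; and $x\mapsto a\cdot x+x$ is bijective. Isomorphisms of braces are bijections preserving $+$ and $\cdot$; the order of a brace is its cardinality. The named braces are the following abelian groups with the following multiplications. $T^{2,2,q}_{\omega,\mu}=\mathbb{Z}_2^2\oplus\mathbb{Z}_q$ (for $\omega,\mu\in\{\pm1\}\le\mathbb{Z}_q^\times$): $\left(\begin{pmatrix} x_1 \\ y_1 \end{pmatrix},a_1\right)\cdot\left(\begin{pmatrix} x_2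 \\ y_2 \end{pmatrix},a_2\right)=\left(\begin{pmatrix} 0 \\ 0 \end{pmatrix},(\omega^{x_1}\mu^{y_1}-1)a_2\right)$. $T^{4,q}_{\omega}=\mathbb{Z}_4\oplus\mathbb{Z}_q$ (for $\omega\in\mathbb{Z}_q^\times$ with $\omega^4=1$): $(x_1,a_1)\cdot(x_2,a_2)=(0,(\omega^{x_1}-1)a_2)$. $B^{2,2,q}_{\omega}=\mathbb{Z}_2^2\oplus\mathbb{Z}_q$ (for $\omega\in\mathbb{Z}_q^\times$ with $\omega^4=1$): $\left(\begin{pmatrix} x_1 \\ y_1 \end{pmatrix},a_1\right)\cdot\left(\begin{pmatrix} x_2 \\ y_2 \end{pmatrix},a_2\right)=\left(\begin{pmatrix} y_1y_2 \\ 0 \end{pmatrix},(\omega^{\underline{x_1y_1}}-1)a_2\right)$. $B^{4,q}_{\omega,\mu}=\mathbb{Z}_4\oplus\mathbb{Z}_q$ (for $\omega,\mu\in\{\pm1\}\le\mathbb{Z}_q^\times$): $(\underline{x_1y_1},a_1)\cdot(\underline{x_2y_2},a_2)=\left(2\,\underline{x_1y_1}\,\underline{x_2y_2},\,(\omega^{x_1}\mu^{y_1}-1)a_2\right)$, where $2\,\underline{x_1y_1}\,\underline{x_2y_2}$ is a product in $\mathbb{Z}_4$. *)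

theory Defs
  imports "HOL-Number_Theory.Residues" "HOL-Algebra.Chinese_Remainder"
begin

text \<open>
  A brace is carried by a \<open>ring\<close> record, so that the library's \<open>abelian_group\<close> applies to its
  additive structure. The field \<open>one\<close> of the record is not part of the brace: no axiom, and no
  condition on isomorphisms, refers to it. In the same way the brace multiplication need not be
  associative, and it is only distributive from the left.
\<close>

locale left_brace = abelian_group A for A (structure) +
  assumes finite_carrier: "finite (carrier A)"
    and mult_closed: "\<lbrakk>a \<in> carrier A; b \<in> carrier A\<rbrakk> \<Longrightarrow> a \<otimes> b \<in> carrier A"
    and left_distrib: "\<lbrakk>a \<in> carrier A; b \<in> carrier A; c \<in> carrier A\<rbrakk>
          \<Longrightarrow> a \<otimes> (b \<oplus> c) = a \<otimes> b \<oplus> a \<otimes> c"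
    and circle_action: "\<lbrakk>a \<in> carrier A; b \<in> carrier A; c \<in> carrier A\<rbrakk>
          \<Longrightarrow> (a \<otimes> b \<oplus> a \<oplus> b) \<otimes> c = a \<otimes> (b \<otimes> c) \<oplus> a \<otimes> c \<oplus> b \<otimes> c"
    and bij_translation: "a \<in> carrier A
          \<Longrightarrow> bij_betw (\<lambda>x. a \<otimes> x \<oplus> x) (carrier A) (carrier A)"

definition brace_isomorphic :: "('a, 'm) ring_scheme \<Rightarrow> ('b, 'n) ring_scheme \<Rightarrow> bool"
  where "brace_isomorphic A B \<longleftrightarrow>
    (\<exists>f. bij_betw f (carrier A) (carrier B) \<and>
         (\<forall>x \<in> carrier A. \<forall>y \<in> carrier A. f (x \<oplus>\<^bsub>A\<^esub> y) = f x \<oplus>\<^bsub>B\<^esub> f y) \<and>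
         (\<forall>x \<in> carrier A. \<forall>y \<in> carrier A. f (x \<otimes>\<^bsub>A\<^esub> y) = f x \<otimes>\<^bsub>B\<^esub> f y))"

text \<open>
  The additive groups are those of \<open>RDirProd\<close>s of the rings \<open>residue_ring n\<close>, whose carrier is
  \<open>{0..n - 1}\<close>; the ring multiplication is then overwritten. The parameters \<open>w\<close> and \<open>m\<close> are
  integers representing units modulo \<open>q\<close>, so that \<open>-1\<close> may be written as such, and powers of
  them are taken on the representatives \<open>x, y \<in> {0, 1}\<close> and \<open>x \<in> {0, 1, 2, 3}\<close>. An element \<open>u\<close>
  of the integers modulo 4 has the binary digits \<open>u div 2\<close> and \<open>u mod 2\<close>.
\<close>

definition brace_T22 :: "nat \<Rightarrow> int \<Rightarrow> int \<Rightarrow> ((int \<times> int) \<times> int) ring"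
  where "brace_T22 q w m =
    (RDirProd (RDirProd (residue_ring 2) (residue_ring 2)) (residue_ring (int q)))
      \<lparr>monoid.mult := \<lambda>((x1, y1), a1) ((x2, y2), a2).
         ((0, 0), ((w ^ nat x1 * m ^ nat y1 - 1) * a2) mod int q)\<rparr>"

definition brace_T4 :: "nat \<Rightarrow> int \<Rightarrow> (int \<times> int) ring"
  where "brace_T4 q w =
    (RDirProd (residue_ring 4) (residue_ring (int q)))
      \<lparr>monoid.mult := \<lambda>(x1, a1) (x2, a2). (0, ((w ^ nat x1 - 1) * a2) mod int q)\<rparr>"

definition brace_B22 :: "nat \<Rightarrow> int \<Rightarrow> ((int \<times> int) \<times> int) ring"
  where "brace_B22 q w =
    (RDirProd (RDirProd (residue_ring 2) (residue_ring 2)) (residue_ring (int q)))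
      \<lparr>monoid.mult := \<lambda>((x1, y1), a1) ((x2, y2), a2).
         (((y1 * y2) mod 2, 0), ((w ^ nat (2 * x1 + y1) - 1) * a2) mod int q)\<rparr>"

definition brace_B4 :: "nat \<Rightarrow> int \<Rightarrow> int \<Rightarrow> (int \<times> int) ring"
  where "brace_B4 q w m =
    (RDirProd (residue_ring 4) (residue_ring (int q)))
      \<lparr>monoid.mult := \<lambda>(u1, a1) (u2, a2).
         ((2 * u1 * u2) mod 4,
          ((w ^ nat (u1 div 2) * m ^ nat (u1 mod 2) - 1) * a2) mod int q)\<rparr>"

text \<open>
  The named braces do not all have the same carrier type. They are therefore listed by labels,
  and the statements about the list are made through the functions below.
\<close>

datatype brace_label = T22 int int | T4 int | B22 int | B4 int int

fun labels_brace_of_order :: "nat \<Rightarrow> nat \<Rightarrow> brace_label \<Rightarrow> bool"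
  where
    "labels_brace_of_order n q (T22 w m) \<longleftrightarrow>
       left_brace (brace_T22 q w m) \<and> order (brace_T22 q w m) = n"
  | "labels_brace_of_order n q (T4 w) \<longleftrightarrow>
       left_brace (brace_T4 q w) \<and> order (brace_T4 q w) = n"
  | "labels_brace_of_order n q (B22 w) \<longleftrightarrow>
       left_brace (brace_B22 q w) \<and> order (brace_B22 q w) = n"
  | "labels_brace_of_order n q (B4 w m) \<longleftrightarrow>
       left_brace (brace_B4 q w m) \<and> order (brace_B4 q w m) = n"

fun isomorphic_to_label :: "nat \<Rightarrow> ('a, 'm) ring_scheme \<Rightarrow> brace_label \<Rightarrow> bool"
  where
    "isomorphic_to_label q A (T22 w m) \<longleftrightarrow> brace_isomorphic A (brace_T22 q w m)"
  | "isomorphic_to_label q A (T4 w) \<longleftrightarrow> brace_isomorphic A (brace_T4 q w)"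
  | "isomorphic_to_label q A (B22 w) \<longleftrightarrow> brace_isomorphic A (brace_B22 q w)"
  | "isomorphic_to_label q A (B4 w m) \<longleftrightarrow> brace_isomorphic A (brace_B4 q w m)"

fun isomorphic_labels :: "nat \<Rightarrow> brace_label \<Rightarrow> brace_label \<Rightarrow> bool"
  where
    "isomorphic_labels q (T22 w m) l \<longleftrightarrow> isomorphic_to_label q (brace_T22 q w m) l"
  | "isomorphic_labels q (T4 w) l \<longleftrightarrow> isomorphic_to_label q (brace_T4 q w) l"
  | "isomorphic_labels q (B22 w) l \<longleftrightarrow> isomorphic_to_label q (brace_B22 q w) l"
  | "isomorphic_labels q (B4 w m) l \<longleftrightarrow> isomorphic_to_label q (brace_B4 q w m) l"

definition primitive_fourth_root_mod :: "nat \<Rightarrow> int \<Rightarrow> bool"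
  where "primitive_fourth_root_mod q w \<longleftrightarrow>
    w \<in> Units (residue_ring (int q)) \<and> group.ord (units_of (residue_ring (int q))) w = 4"

definition brace_list :: "nat \<Rightarrow> int \<Rightarrow> brace_label set"
  where "brace_list q w =
    {T22 1 1, T22 (-1) 1, T4 1, T4 (-1), B22 1, B22 (-1), B4 1 1, B4 1 (-1), B4 (-1) 1} \<union>
    (if 4 dvd q - 1 then {T4 w, B22 w} else {})"

end

theory Submission
  imports Defs "HOL-Algebra.Sylow"
begin

text \<open>
  Write \<open>lam a x = a \<cdot> x + x\<close>. The additive Sylow subgroups \<open>P\<close> and \<open>H\<close>, of orders \<open>4\<close> and \<open>q\<close>,
  are stable under every \<open>lam a\<close>. For \<open>a \<in> H\<close> the \<open>q\<close>-th power of \<open>lam a\<close> is the identity, because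
  the circle group of \<open>H\<close> has order \<open>q\<close>; since \<open>P\<close> and \<open>H - {0}\<close> have fewer than \<open>q\<close> elements,
  \<open>lam a\<close> is trivial on both. Hence the multiplication is determined by the brace \<open>P\<close> of order \<open>4\<close>
  and the character by which its circle group acts on \<open>H\<close>. There are four braces of order \<open>4\<close>, and
  their characters are classified up to brace automorphisms. Five first-order properties of the
  braces distinguish the resulting list.
\<close>

section \<open>Braces and their circle groups\<close>

text \<open>Only left distributivity holds, so knowing that \<open>H\<close> annihilates everything
  as a left factor does not by itself reduce \<open>p \<oplus> h\<close> to \<open>p\<close>. The
  circle product is the substitute for right distributivity: it makes
  \<open>a \<mapsto> lam a\<close> a group action, whose orbits can be compared with orders of
  circle subgroups. The hypotheses on \<open>q\<close> give \<open>q \<ge> 5\<close>, so a set of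
  four elements is too small for an orbit of length \<open>q\<close>.

  The shape of the list reflects the circle groups of the four braces of order 4. For a trivial
  multiplication the circle group is the additive group; each nontrivial one exchanges the cyclic
  group and the Klein four group. Hence the families \<open>T4\<close> and \<open>B22\<close> have a
  cyclic circle group, their characters are fourth roots of unity, and an automorphism identifies a
  primitive root with its inverse. The families \<open>T22\<close> and \<open>B4\<close> have a
  Klein four circle group and characters given by two signs. The automorphisms leave one nontrivial
  character for \<open>T22\<close>, but two for \<open>B4\<close>, where only negation is
  available.\<close>

definition circle_group :: "('a, 'm) ring_scheme \<Rightarrow> 'a monoid"
  where "circle_group A = \<lparr>carrier = carrier A,
    monoid.mult = \<lambda>a b. a \<otimes>\<^bsub>A\<^esub> b \<oplus>\<^bsub>A\<^esub> a \<oplus>\<^bsub>A\<^esub> b, one = \<zero>\<^bsub>A\<^esub>\<rparr>"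

context left_brace
begin

definition lam :: "'a \<Rightarrow> 'a \<Rightarrow> 'a"
  where "lam a x = a \<otimes> x \<oplus> x"

lemma lam_closed [simp]: "\<lbrakk>a \<in> carrier A; x \<in> carrier A\<rbrakk> \<Longrightarrow> lam a x \<in> carrier A"
  by (simp add: lam_def mult_closed)

declare mult_closed [simp]

lemma mult_zero [simp]: "a \<otimes> \<zero> = \<zero>" if "a \<in> carrier A"
  using left_distrib[of a \<zero> \<zero>] that by (metis add.r_cancel_one' mult_closed r_zero zero_closed)

text \<open>The circle law at \<open>a = b = \<zero>\<close> puts \<open>\<zero> \<otimes> x\<close>
  into the kernel of \<open>lam \<zero>\<close>, which is injective.\<close>

lemma zero_mult [simp]: "\<zero> \<otimes> x = \<zero>" if "x \<in> carrier A"
proof -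
  have "\<zero> \<otimes> x = \<zero> \<otimes> (\<zero> \<otimes> x) \<oplus> \<zero> \<otimes> x \<oplus> \<zero> \<otimes> x"
    using circle_action[of \<zero> \<zero> x] that by simp
  then have "lam \<zero> (\<zero> \<otimes> x) = lam \<zero> \<zero>"
    using that by (simp add: lam_def)
  then show ?thesis
    using bij_translation[of \<zero>] that unfolding bij_betw_def inj_on_def lam_def
    by (metis mult_closed zero_closed)
qed

lemma lam_zero [simp]: "a \<in> carrier A \<Longrightarrow> lam a \<zero> = \<zero>"
  by (simp add: lam_def)

lemma zero_lam [simp]: "x \<in> carrier A \<Longrightarrow> lam \<zero> x = x"
  by (simp add: lam_def)

lemma mult_eq_zero_iff_lam: "\<lbrakk>a \<in> carrier A; x \<in> carrier A\<rbrakk> \<Longrightarrow> a \<otimes> x = \<zero> \<longleftrightarrow> lam a x = x"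
  by (simp add: lam_def)

text \<open>Left multiplications are additive endomorphisms. Through this, they preserve every
  subgroup that is cut out by a torsion condition.\<close>

lemma mult_add_pow: "a \<otimes> ([k] \<cdot> x) = [k] \<cdot> (a \<otimes> x)"
  if "a \<in> carrier A" "x \<in> carrier A" for k :: int
proof -
  have "(\<lambda>x. a \<otimes> x) \<in> hom (add_monoid A) (add_monoid A)"
    using that by (simp add: hom_def left_distrib)
  from hom_int_pow[OF this _ a_group a_group] show ?thesis
    using that by (simp add: add_pow_def)
qed

lemma lam_inj: "\<lbrakk>a \<in> carrier A; x \<in> carrier A; y \<in> carrier A; lam a x = lam a y\<rbrakk> \<Longrightarrow> x = y"
  using bij_translation[of a] unfolding bij_betw_def inj_on_def lam_def by blast

text \<open>The circle axiom is, after adding the missing terms, the statement that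
  \<open>lam\<close> is an action of the circle group.\<close>

lemma lam_lam: "\<lbrakk>a \<in> carrier A; b \<in> carrier A; x \<in> carrier A\<rbrakk>
    \<Longrightarrow> lam (a \<otimes> b \<oplus> a \<oplus> b) x = lam a (lam b x)"
  by (simp add: lam_def circle_action left_distrib, simp add: a_ac)

lemma group_circle: "group (circle_group A)"
proof (rule groupI)
  show "\<one>\<^bsub>circle_group A\<^esub> \<in> carrier (circle_group A)"
    by (simp add: circle_group_def)
next
  fix x y z
  assume xyz: "x \<in> carrier (circle_group A)" "y \<in> carrier (circle_group A)"
    "z \<in> carrier (circle_group A)"
  then show "x \<otimes>\<^bsub>circle_group A\<^esub> y \<in> carrier (circle_group A)"
    by (simp add: circle_group_def)
  show "x \<otimes>\<^bsub>circle_group A\<^esub> y \<otimes>\<^bsub>circle_group A\<^esub> z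
      = x \<otimes>\<^bsub>circle_group A\<^esub> (y \<otimes>\<^bsub>circle_group A\<^esub> z)"
    using xyz by (simp add: circle_group_def circle_action left_distrib, simp add: a_ac)
  show "\<one>\<^bsub>circle_group A\<^esub> \<otimes>\<^bsub>circle_group A\<^esub> x = x"
    using xyz by (simp add: circle_group_def)
next
  \<comment> \<open>Surjectivity of \<open>lam a\<close> at \<open>\<ominus> a\<close> gives only a
    right circle inverse, whereas \<open>groupI\<close> asks for a left one.\<close>
  have ex_inv: "\<exists>b\<in>carrier A. a \<otimes> b \<oplus> a \<oplus> b = \<zero>" if a: "a \<in> carrier A" for a
  proof -
    have "\<ominus> a \<in> (\<lambda>x. a \<otimes> x \<oplus> x) ` carrier A"
      using bij_translation[OF a] a by (simp add: bij_betw_def)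
    then obtain b where b: "b \<in> carrier A" "a \<otimes> b \<oplus> b = \<ominus> a"
      by auto
    then have "a \<otimes> b \<oplus> a \<oplus> b = a \<oplus> (a \<otimes> b \<oplus> b)"
      using a by (simp add: a_ac)
    then show ?thesis
      using a b by (auto simp: r_neg)
  qed
  fix x
  assume "x \<in> carrier (circle_group A)"
  then have x: "x \<in> carrier A" by (simp add: circle_group_def)
  obtain y where y: "y \<in> carrier A" "x \<otimes> y \<oplus> x \<oplus> y = \<zero>"
    using ex_inv[OF x] by blast
  obtain z where z: "z \<in> carrier A" "y \<otimes> z \<oplus> y \<oplus> z = \<zero>"
    using ex_inv[OF y(1)] by blast
  \<comment> \<open>As \<open>y\<close> is a right inverse of \<open>x\<close> and \<open>z\<close>
    one of \<open>y\<close>, associativity forces \<open>z = x\<close>; so \<open>y\<close> is also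
    a left inverse of \<open>x\<close>.\<close>
  have "z = (x \<otimes> y \<oplus> x \<oplus> y) \<otimes> z \<oplus> (x \<otimes> y \<oplus> x \<oplus> y) \<oplus> z"
    using y z by simp
  also have "\<dots> = x \<otimes> (y \<otimes> z \<oplus> y \<oplus> z) \<oplus> x \<oplus> (y \<otimes> z \<oplus> y \<oplus> z)"
    using x y(1) z(1) by (simp add: circle_action left_distrib, simp add: a_ac)
  also have "\<dots> = x"
    using x z by simp
  finally show "\<exists>y\<in>carrier (circle_group A). y \<otimes>\<^bsub>circle_group A\<^esub> x = \<one>\<^bsub>circle_group A\<^esub>"
    using y(1) z by (auto simp: circle_group_def)
qed

lemma circle_pow_closed: "a \<in> carrier A \<Longrightarrow> a [^]\<^bsub>circle_group A\<^esub> (n::nat) \<in> carrier A"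
  using monoid.nat_pow_closed[OF group.is_monoid[OF group_circle], of a n] by (simp add: circle_group_def)

lemma lam_circle_pow: "lam (a [^]\<^bsub>circle_group A\<^esub> n) x = (lam a ^^ n) x"
  if "a \<in> carrier A" "x \<in> carrier A" for n :: nat
  using that(2)
proof (induction n arbitrary: x)
  case 0
  then show ?case by (simp add: circle_group_def)
next
  case (Suc n)
  have "a [^]\<^bsub>circle_group A\<^esub> (Suc n) =
     a [^]\<^bsub>circle_group A\<^esub> n \<otimes> a \<oplus> a [^]\<^bsub>circle_group A\<^esub> n \<oplus> a"
    by (simp add: nat_pow_def circle_group_def)
  then show ?case
    using Suc that(1) by (simp add: lam_lam circle_pow_closed funpow_swap1)
qed

text \<open>Bijectivity of the translations survives the restriction because an injective self-map
  of a finite set is onto.\<close>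

lemma left_brace_subset:
  assumes "subgroup H (add_monoid A)" "\<And>a b. \<lbrakk>a \<in> H; b \<in> H\<rbrakk> \<Longrightarrow> a \<otimes> b \<in> H"
  shows "left_brace (A\<lparr>carrier := H\<rparr>)"
proof -
  have H: "H \<subseteq> carrier A" using subgroup.subset[OF assms(1)] by simp
  then have fin: "finite H" using finite_carrier finite_subset by blast
  have add_H: "a \<oplus> b \<in> H" if "a \<in> H" "b \<in> H" for a b
    using subgroup.m_closed[OF assms(1)] that by simp
  have 1: "comm_group (add_monoid A\<lparr>carrier := H\<rparr>)"
    by (rule group.group_comm_groupI[OF subgroup.subgroup_is_group[OF assms(1) a_group]])
      (use H in \<open>auto intro: a_comm\<close>)
  then have "abelian_group (A\<lparr>carrier := H\<rparr>)"
    by (intro comm_group_abelian_groupI) simp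
  moreover have "bij_betw (\<lambda>x. a \<otimes> x \<oplus> x) H H" if a: "a \<in> H" for a
  proof -
    have "inj_on (\<lambda>x. a \<otimes> x \<oplus> x) H"
      using bij_translation[of a] a H by (auto simp: bij_betw_def intro: inj_on_subset)
    moreover have "(\<lambda>x. a \<otimes> x \<oplus> x) ` H \<subseteq> H"
      using a assms(2) add_H by auto
    ultimately show ?thesis
      using fin by (simp add: bij_betw_def endo_inj_surj)
  qed
  ultimately show ?thesis
    using H fin assms(2) by (auto simp: left_brace_def left_brace_axioms_def left_distrib circle_action subset_iff)
qed

text \<open>Lagrange's theorem in the circle group of the sub-brace \<open>H\<close>, whose order is
  \<open>card H\<close>. The circle power of \<open>a\<close> itself vanishes, so the identity holds
  on all of \<open>A\<close> and not just on \<open>H\<close>.\<close>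

lemma lam_funpow_card:
  assumes H: "subgroup H (add_monoid A)" "\<And>a b. \<lbrakk>a \<in> H; b \<in> H\<rbrakk> \<Longrightarrow> a \<otimes> b \<in> H"
    and a: "a \<in> H" and x: "x \<in> carrier A"
  shows "(lam a ^^ card H) x = x"
proof -
  interpret B: left_brace "A\<lparr>carrier := H\<rparr>"
    by (rule left_brace_subset) fact+
  have aA: "a \<in> carrier A" using subgroup.mem_carrier[OF H(1) a] by simp
  have "a [^]\<^bsub>circle_group (A\<lparr>carrier := H\<rparr>)\<^esub> order (circle_group (A\<lparr>carrier := H\<rparr>))
      = \<one>\<^bsub>circle_group (A\<lparr>carrier := H\<rparr>)\<^esub>"
    by (rule group.pow_order_eq_1[OF B.group_circle]) (simp add: circle_group_def a)
  then have "a [^]\<^bsub>circle_group A\<^esub> card H = \<zero>"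
    by (simp add: circle_group_def order_def nat_pow_def)
  then show ?thesis
    using lam_circle_pow[OF aA x, of "card H"] x by simp
qed

end

section \<open>Decomposition of a brace of order 4q\<close>

text \<open>For a character \<open>chi\<close> the circle group is the semidirect product of the
  integers modulo \<open>q\<close> by the circle group of \<open>P\<close>, acting through
  \<open>chi\<close>: the second coordinate of a circle product is \<open>a + chi x * b\<close>.
  Only the residues of the values of \<open>chi\<close> matter.\<close>

definition brace_extension ::
    "('a, 'm) ring_scheme \<Rightarrow> ('a \<Rightarrow> int) \<Rightarrow> nat \<Rightarrow> ('a \<times> int) ring"
  where "brace_extension P chi q =
    (RDirProd P (residue_ring (int q)))
      \<lparr>monoid.mult := \<lambda>(x, a) (y, b). (x \<otimes>\<^bsub>P\<^esub> y, ((chi x - 1) * b) mod int q)\<rparr>"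

text \<open>A homomorphism on the circle group of \<open>P\<close>, not on its additive group. Its
  values are units modulo \<open>q\<close> because circle inverses have reciprocal values.\<close>

definition brace_character :: "('a, 'm) ring_scheme \<Rightarrow> ('a \<Rightarrow> int) \<Rightarrow> nat \<Rightarrow> bool"
  where "brace_character P chi q \<longleftrightarrow>
    [chi \<zero>\<^bsub>P\<^esub> = 1] (mod int q) \<and>
    (\<forall>x \<in> carrier P. \<forall>y \<in> carrier P.
       [chi (x \<otimes>\<^bsub>P\<^esub> y \<oplus>\<^bsub>P\<^esub> x \<oplus>\<^bsub>P\<^esub> y) = chi x * chi y] (mod int q))"

lemma brace_extension_simps [simp]:
  "carrier (brace_extension P chi q) = carrier P \<times> {0..int q - 1}"
  "(x, a) \<oplus>\<^bsub>brace_extension P chi q\<^esub> (y, b) = (x \<oplus>\<^bsub>P\<^esub> y, (a + b) mod int q)"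
  "(x, a) \<otimes>\<^bsub>brace_extension P chi q\<^esub> (y, b) = (x \<otimes>\<^bsub>P\<^esub> y, ((chi x - 1) * b) mod int q)"
  "\<zero>\<^bsub>brace_extension P chi q\<^esub> = (\<zero>\<^bsub>P\<^esub>, 0)"
  by (simp_all add: brace_extension_def RDirProd_def DirProd_def monoid.defs residue_ring_def)

text \<open>The period of \<open>x\<close> divides the prime \<open>q\<close> and is smaller than
  \<open>q\<close>, as the orbit stays in \<open>S\<close>; hence it is 1.\<close>

lemma funpow_prime_fixed_point:
  assumes q: "prime q" and fq: "(f ^^ q) x = x"
    and S: "finite S" "card S < q" "\<And>n. (f ^^ n) x \<in> S"
  shows "f x = x"
proof -
  have "\<not> inj_on (\<lambda>n. (f ^^ n) x) {..<q}"
    using card_inj_on_le[of "\<lambda>n. (f ^^ n) x" "{..<q}" S] S by auto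
  then obtain i j where ij: "i < j" "j < q" "(f ^^ i) x = (f ^^ j) x"
    unfolding inj_on_def by (metis lessThan_iff linorder_neqE_nat)
  \<comment> \<open>Applying \<open>f\<close> another \<open>q - j\<close> times to both sides of
    the collision turns the right one into \<open>x\<close>, without cancelling iterates.\<close>
  define d where "d = q - j + i"
  have "(f ^^ d) x = (f ^^ (q - j)) ((f ^^ j) x)"
    by (simp only: d_def funpow_add o_apply ij(3))
  also have "\<dots> = (f ^^ (q - j + j)) x"
    by (simp only: funpow_add o_apply)
  also have "\<dots> = (f ^^ q) x"
    using ij by simp
  finally have d: "(f ^^ d) x = x" using fq by simp
  have "0 < d" "d < q" using ij by (auto simp: d_def)
  then have "coprime d q"
    using q by (metis coprime_commute nat_dvd_not_less prime_imp_coprime)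
  then obtain m where m: "[d * m = 1] (mod q)"
    using cong_solve_coprime_nat[of d q] by auto
  have "(f ^^ (d * m)) x = x" for m
    using d by (induction m) (simp_all add: funpow_add)
  then have "x = (f ^^ (d * m mod q)) x"
    using funpow_mod_eq[OF fq, of "d * m"] by simp
  also have "d * m mod q = 1"
    using m prime_gt_1_nat[OF q] by (simp add: cong_def)
  finally show ?thesis by simp
qed

lemma (in abelian_group) subgroup_torsion:
  assumes "subgroup H (add_monoid G)" "x \<in> H"
  shows "[(int (card H))] \<cdot> x = \<zero>"
proof -
  have "x [^]\<^bsub>add_monoid G\<lparr>carrier := H\<rparr>\<^esub> order (add_monoid G\<lparr>carrier := H\<rparr>) = \<one>\<^bsub>add_monoid G\<lparr>carrier := H\<rparr>\<^esub>"
    by (rule group.pow_order_eq_1[OF subgroup.subgroup_is_group[OF assms(1) a_group]])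
       (simp add: assms(2))
  then show ?thesis
    by (simp add: order_def add_pow_def int_pow_int nat_pow_def)
qed

locale brace_4q = left_brace +
  fixes q :: nat and P H
  assumes q: "prime q" "q > 3" and order_A: "order A = 4 * q"
    and P: "subgroup P (add_monoid A)" "card P = 4"
    and H: "subgroup H (add_monoid A)" "card H = q"
begin

text \<open>The strict bound yields \<open>card P < q\<close> and excludes
  \<open>q dvd 4\<close>.\<close>

lemma q_gt_4: "q > 4"
proof -
  have "\<not> prime (4::nat)" by (auto simp: prime_nat_iff intro!: exI[of _ 2])
  then show ?thesis using q by (cases "q = 4") auto
qed

lemma P_carrier: "p \<in> P \<Longrightarrow> p \<in> carrier A"
  and H_carrier: "h \<in> H \<Longrightarrow> h \<in> carrier A"
  using subgroup.mem_carrier[OF P(1)] subgroup.mem_carrier[OF H(1)] by simp_all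

lemma P_closed: "\<zero> \<in> P" "\<lbrakk>x \<in> P; y \<in> P\<rbrakk> \<Longrightarrow> x \<oplus> y \<in> P" "\<lbrakk>x \<in> P; y \<in> P\<rbrakk> \<Longrightarrow> x \<ominus> y \<in> P"
  using subgroup.one_closed[OF P(1)] subgroup.m_closed[OF P(1)] subgroup.m_inv_closed[OF P(1)]
  by (auto simp: a_inv_def a_minus_def)

lemma H_closed: "\<zero> \<in> H" "\<lbrakk>x \<in> H; y \<in> H\<rbrakk> \<Longrightarrow> x \<oplus> y \<in> H" "\<lbrakk>x \<in> H; y \<in> H\<rbrakk> \<Longrightarrow> x \<ominus> y \<in> H"
  using subgroup.one_closed[OF H(1)] subgroup.m_closed[OF H(1)] subgroup.m_inv_closed[OF H(1)]
  by (auto simp: a_inv_def a_minus_def)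

lemma finite_P: "finite P" and finite_H: "finite H"
  using P(2) H(2) q(2) by (auto intro: card_ge_0_finite)

lemma P_torsion: "x \<in> P \<Longrightarrow> [(4::int)] \<cdot> x = \<zero>"
  and H_torsion: "x \<in> H \<Longrightarrow> [(int q)] \<cdot> x = \<zero>"
  using subgroup_torsion[OF P(1)] subgroup_torsion[OF H(1)] P(2) H(2) by simp_all

lemma torsion_disjoint:
  assumes x: "x \<in> carrier A" and "[(4::int)] \<cdot> x = \<zero>" "[(int q)] \<cdot> x = \<zero>"
  shows "x = \<zero>"
proof -
  have "int (add.ord x) dvd 4" "int (add.ord x) dvd int q"
    using assms by (simp_all add: add.int_pow_eq_id)
  moreover have "\<not> q dvd 4" using q_gt_4 by (auto dest: dvd_imp_le)
  then have "coprime 4 (int q)"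
    using q(1) by (metis coprime_commute of_nat_dvd_iff of_nat_numeral prime_imp_coprime prime_int_nat_transfer prime_nat_int_transfer)
  ultimately have "int (add.ord x) dvd 1"
    using coprime_common_divisor by blast
  then have "[(1::int)] \<cdot> x = \<zero>"
    using x add.int_pow_eq_id by blast
  then show ?thesis using x by simp
qed

text \<open>Two equal sums give \<open>p \<ominus> p' = h' \<ominus> h\<close>, an element killed by
  both 4 and \<open>q\<close>, hence zero. Surjectivity is then a count.\<close>

lemma sum_bij: "bij_betw (\<lambda>(p, h). p \<oplus> h) (P \<times> H) (carrier A)"
proof -
  have inj: "inj_on (\<lambda>(p, h). p \<oplus> h) (P \<times> H)"
  proof (rule inj_onI, clarify)
    fix p h p' h'
    assume *: "p \<in> P" "h \<in> H" "p' \<in> P" "h' \<in> H" "p \<oplus> h = p' \<oplus> h'"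
    have c: "p \<in> carrier A" "h \<in> carrier A" "p' \<in> carrier A" "h' \<in> carrier A"
      using * P_carrier H_carrier by auto
    have "p \<ominus> p' = (p \<oplus> h) \<oplus> (\<ominus> h \<oplus> \<ominus> p')"
      using c by (simp add: a_minus_def a_assoc r_neg2)
    also have "\<dots> = (h' \<oplus> p') \<oplus> (\<ominus> p' \<oplus> \<ominus> h)"
      unfolding *(5) using c by (simp add: a_comm)
    also have "\<dots> = h' \<ominus> h"
      using c by (simp add: a_minus_def a_assoc r_neg2)
    finally have e: "p \<ominus> p' = h' \<ominus> h" .
    have "p \<ominus> p' = \<zero>"
    proof (rule torsion_disjoint)
      show "[(4::int)] \<cdot> (p \<ominus> p') = \<zero>"
        using P_torsion[OF P_closed(3)[OF *(1,3)]] .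
      show "[(int q)] \<cdot> (p \<ominus> p') = \<zero>"
        unfolding e using H_torsion[OF H_closed(3)[OF *(4,2)]] .
    qed (use c in simp)
    then have "p \<oplus> \<ominus> p' = \<zero>" "h' \<oplus> \<ominus> h = \<zero>"
      using e by (simp_all add: a_minus_def)
    then show "p = p' \<and> h = h'"
      using c minus_equality minus_minus by (metis a_inv_closed)
  qed
  have "(\<lambda>(p, h). p \<oplus> h) ` (P \<times> H) = carrier A"
  proof (rule card_subset_eq[OF finite_carrier])
    show "(\<lambda>(p, h). p \<oplus> h) ` (P \<times> H) \<subseteq> carrier A"
      using P_carrier H_carrier by auto
    show "card ((\<lambda>(p, h). p \<oplus> h) ` (P \<times> H)) = card (carrier A)"
      using card_image[OF inj] P(2) H(2) order_A by (simp add: card_cartesian_product order_def)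
  qed
  with inj show ?thesis by (simp add: bij_betw_def)
qed

lemma sum_cases:
  assumes "x \<in> carrier A"
  obtains p h where "p \<in> P" "h \<in> H" "x = p \<oplus> h"
proof -
  have "x \<in> (\<lambda>(p, h). p \<oplus> h) ` (P \<times> H)"
    using sum_bij assms by (simp add: bij_betw_def)
  then show ?thesis using that by auto
qed

text \<open>Together with \<open>P_torsion\<close>, this describes \<open>P\<close> by torsion
  alone, and \<open>H_memI\<close> does the same for \<open>H\<close>. An arbitrary additive
  subgroup may fail to be stable under left multiplications; a torsion subgroup cannot.\<close>

lemma P_memI: "x \<in> P" if x: "x \<in> carrier A" "[(4::int)] \<cdot> x = \<zero>"
proof -
  obtain p h where ph: "p \<in> P" "h \<in> H" "x = p \<oplus> h" by (rule sum_cases[OF x(1)])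
  have c: "p \<in> carrier A" "h \<in> carrier A" using ph P_carrier H_carrier by auto
  have "[(4::int)] \<cdot> h = \<zero>"
    using x ph c P_torsion[OF ph(1)] by (simp add: add.int_pow_distrib)
  then have "h = \<zero>" using torsion_disjoint[OF c(2)] H_torsion[OF ph(2)] by simp
  then show ?thesis using ph c by simp
qed

lemma H_memI: "x \<in> H" if x: "x \<in> carrier A" "[(int q)] \<cdot> x = \<zero>"
proof -
  obtain p h where ph: "p \<in> P" "h \<in> H" "x = p \<oplus> h" by (rule sum_cases[OF x(1)])
  have c: "p \<in> carrier A" "h \<in> carrier A" using ph P_carrier H_carrier by auto
  have "[(int q)] \<cdot> p = \<zero>"
    using x ph c H_torsion[OF ph(2)] by (simp add: add.int_pow_distrib)
  then have "p = \<zero>" using torsion_disjoint[OF c(1)] P_torsion[OF ph(1)] by simp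
  then show ?thesis using ph c by simp
qed

lemma mult_P: "\<lbrakk>a \<in> carrier A; x \<in> P\<rbrakk> \<Longrightarrow> a \<otimes> x \<in> P"
  by (intro P_memI) (simp_all add: P_carrier P_torsion flip: mult_add_pow)

lemma mult_H: "\<lbrakk>a \<in> carrier A; x \<in> H\<rbrakk> \<Longrightarrow> a \<otimes> x \<in> H"
  by (intro H_memI) (simp_all add: H_carrier H_torsion flip: mult_add_pow)

lemma lam_P: "\<lbrakk>a \<in> carrier A; x \<in> P\<rbrakk> \<Longrightarrow> lam a x \<in> P"
  and lam_H: "\<lbrakk>a \<in> carrier A; x \<in> H\<rbrakk> \<Longrightarrow> lam a x \<in> H"
  by (simp_all add: lam_def mult_P mult_H P_closed H_closed)

lemma lam_funpow_H: "\<lbrakk>a \<in> H; x \<in> carrier A\<rbrakk> \<Longrightarrow> (lam a ^^ q) x = x"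
  using lam_funpow_card[OF H(1), of a x] H(2) mult_H H_carrier by simp

lemma H_mult_eq_zero:
  assumes a: "a \<in> H" and x: "x \<in> carrier A"
  shows "a \<otimes> x = \<zero>"
proof -
  have aA: "a \<in> carrier A" using a H_carrier by simp
  have fixP: "a \<otimes> p = \<zero>" if p: "p \<in> P" for p
  proof -
    have "lam a p = p"
    proof (rule funpow_prime_fixed_point[OF q(1) lam_funpow_H])
      show "(lam a ^^ n) p \<in> P" for n
        using p aA lam_P by (induction n) auto
    qed (use a p P_carrier finite_P P(2) q_gt_4 in auto)
    then show ?thesis using mult_eq_zero_iff_lam aA p P_carrier by simp
  qed
  have fixH: "a \<otimes> h = \<zero>" if h: "h \<in> H" for h
  proof (cases "h = \<zero>")
    case False
    have "lam a h = h"
    proof (rule funpow_prime_fixed_point[OF q(1) lam_funpow_H])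
      \<comment> \<open>Injectivity of \<open>lam a\<close> and
        \<open>lam a \<zero> = \<zero>\<close> keep the orbit away from zero.\<close>
      show "(lam a ^^ n) h \<in> H - {\<zero>}" for n
      proof (induction n)
        case (Suc n)
        then have "lam a ((lam a ^^ n) h) \<noteq> \<zero>"
          using lam_inj[OF aA, of "(lam a ^^ n) h" \<zero>] H_carrier aA by auto
        then show ?case using Suc aA lam_H by simp
      qed (use False h in simp)
      show "card (H - {\<zero>}) < q"
        using H(2) q(2) H_closed(1) finite_H by (simp add: card_Diff_singleton)
    qed (use a h H_carrier finite_H in auto)
    then show ?thesis using mult_eq_zero_iff_lam aA h H_carrier by simp
  qed (use aA in simp)
  obtain p h where "p \<in> P" "h \<in> H" "x = p \<oplus> h" by (rule sum_cases[OF x])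
  then show ?thesis
    using left_distrib[OF aA] fixP fixH P_carrier H_carrier by simp
qed

lemma sum_mult:
  assumes p: "p \<in> P" and h: "h \<in> H" and x: "x \<in> carrier A"
  shows "(p \<oplus> h) \<otimes> x = p \<otimes> x"
proof -
  have pA: "p \<in> carrier A" using p P_carrier by simp
  have "inj_on (lam p) H"
    using lam_inj[OF pA] H_carrier by (auto simp: inj_on_def)
  moreover have "lam p ` H \<subseteq> H"
    using pA lam_H by auto
  ultimately have "lam p ` H = H"
    by (intro endo_inj_surj finite_H)
  with h have "h \<in> lam p ` H" by simp
  \<comment> \<open>Then \<open>p + h\<close> is the circle product of \<open>p\<close> and \<open>b\<close>, where \<open>lam b\<close> is trivial.\<close>
  then obtain b where b: "b \<in> H" "h = lam p b" by (rule imageE)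
  have bA: "b \<in> carrier A" using b H_carrier by simp
  have "p \<oplus> h = p \<otimes> b \<oplus> p \<oplus> b"
    unfolding b(2) lam_def
    using pA bA by (simp add: a_assoc a_lcomm[of p "p \<otimes> b" b])
  then have "(p \<oplus> h) \<otimes> x = (p \<otimes> b \<oplus> p \<oplus> b) \<otimes> x"
    by (rule arg_cong)
  also have "\<dots> = p \<otimes> (b \<otimes> x) \<oplus> p \<otimes> x \<oplus> b \<otimes> x"
    by (rule circle_action[OF pA bA x])
  also have "\<dots> = p \<otimes> x"
    using pA x by (simp add: H_mult_eq_zero[OF b(1) x])
  finally show ?thesis .
qed

text \<open>Any nonzero element serves as \<open>g\<close>, because its order divides the prime
  \<open>q\<close>. The last clause lets equations between multiples of \<open>g\<close> be read as
  congruences.\<close>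

lemma H_cyclic:
  obtains g where "g \<in> H" "\<forall>h \<in> H. \<exists>k \<in> {0..int q - 1}. h = [k] \<cdot> g"
    "\<forall>k l. [k] \<cdot> g = [l] \<cdot> g \<longleftrightarrow> [k = l] (mod int q)"
proof -
  have "card (H - {\<zero>}) > 0"
    using H(2) q(2) H_closed(1) finite_H by (simp add: card_Diff_singleton)
  then obtain g where g: "g \<in> H" "g \<noteq> \<zero>"
    by (metis Diff_iff card_gt_0_iff ex_in_conv insertI1)
  have gA: "g \<in> carrier A" using g H_carrier by simp
  have "int (add.ord g) dvd int q"
    using H_torsion[OF g(1)] gA by (simp add: add.int_pow_eq_id)
  moreover have "add.ord g \<noteq> 1"
    using add.int_pow_eq_id[OF gA, of 1] gA g(2) by auto
  ultimately have ord: "add.ord g = q"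
    using q(1) unfolding prime_nat_iff by (metis of_nat_dvd_iff)
  have eq: "[k] \<cdot> g = [l] \<cdot> g \<longleftrightarrow> [k = l] (mod int q)" for k l :: int
    using add.int_pow_eq[OF gA, of k l] by (simp add: ord cong_iff_dvd_diff dvd_diff_commute)
  have mem: "[k] \<cdot> g \<in> H" for k :: int
  proof -
    have "[(int q)] \<cdot> ([k] \<cdot> g) = [k] \<cdot> ([(int q)] \<cdot> g)"
      using gA by (simp only: add.int_pow_pow mult.commute)
    then show ?thesis using H_memI[of "[k] \<cdot> g"] H_torsion[OF g(1)] gA by simp
  qed
  have inj: "inj_on (\<lambda>k. [k] \<cdot> g) {0..int q - 1}"
    by (auto simp: inj_on_def eq cong_def)
  have "(\<lambda>k. [k] \<cdot> g) ` {0..int q - 1} = H"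
    by (rule card_subset_eq[OF finite_H]) (use mem card_image[OF inj] H(2) in auto)
  then show thesis using that[of g] g eq by blast
qed

lemma isomorphic_extension:
  obtains chi where "brace_character (A\<lparr>carrier := P\<rparr>) chi q"
    "brace_isomorphic (brace_extension (A\<lparr>carrier := P\<rparr>) chi q) A"
proof -
  obtain g where g: "g \<in> H" "\<forall>h \<in> H. \<exists>k \<in> {0..int q - 1}. h = [k] \<cdot> g"
    "\<forall>k l. [k] \<cdot> g = [l] \<cdot> g \<longleftrightarrow> [k = l] (mod int q)"
    by (rule H_cyclic)
  have gA: "g \<in> carrier A" using g H_carrier by simp
  \<comment> \<open>The shift by one makes \<open>chi p\<close> the eigenvalue of
    \<open>lam p\<close> on \<open>g\<close>, as
    \<open>lam p g = p \<otimes> g \<oplus> g\<close>.\<close>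
  have "\<forall>p\<in>P. \<exists>k. p \<otimes> g = [(k - 1 :: int)] \<cdot> g"
  proof
    fix p assume "p \<in> P"
    then obtain k where "p \<otimes> g = [(k :: int)] \<cdot> g"
      using g(2) mult_H[OF P_carrier g(1)] by blast
    then show "\<exists>k. p \<otimes> g = [(k - 1 :: int)] \<cdot> g"
      by (intro exI[of _ "k + 1"]) simp
  qed
  then obtain chi where chi: "\<And>p. p \<in> P \<Longrightarrow> p \<otimes> g = [(chi p - 1 :: int)] \<cdot> g"
    by metis
  have "[(0::int)] \<cdot> g = [(chi \<zero> - 1)] \<cdot> g"
    using chi[OF P_closed(1)] gA by (simp add: add_pow_def)
  then have chi_zero: "[chi \<zero> = 1] (mod int q)"
    unfolding g(3)[rule_format] by (simp add: cong_iff_dvd_diff dvd_diff_commute)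
  have chi_mult: "[chi (x \<otimes> y \<oplus> x \<oplus> y) = chi x * chi y] (mod int q)"
    if xy: "x \<in> P" "y \<in> P" for x y
  proof -
    have c: "x \<in> carrier A" "y \<in> carrier A" using xy P_carrier by auto
    have "x \<otimes> y \<oplus> x \<oplus> y \<in> P" using xy c mult_P P_closed by simp
    then have "[(chi (x \<otimes> y \<oplus> x \<oplus> y) - 1)] \<cdot> g = x \<otimes> (y \<otimes> g) \<oplus> x \<otimes> g \<oplus> y \<otimes> g"
      using chi[of "x \<otimes> y \<oplus> x \<oplus> y"] c gA circle_action[of x y g] by simp
    \<comment> \<open>The coefficient equals \<open>chi x * chi y - 1\<close>, so the circle law at
      \<open>g\<close> becomes multiplicativity of \<open>chi\<close>.\<close>
    also have "\<dots> = [((chi x - 1) * (chi y - 1) + (chi x - 1) + (chi y - 1))] \<cdot> g"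
      using xy c gA by (simp only: chi mult_add_pow add.int_pow_mult add.int_pow_pow add.int_pow_closed)
    finally show ?thesis
      unfolding g(3)[rule_format] by (simp add: cong_iff_dvd_diff algebra_simps)
  qed
  have char: "brace_character (A\<lparr>carrier := P\<rparr>) chi q"
    using chi_zero chi_mult by (simp add: brace_character_def)
  let ?E = "brace_extension (A\<lparr>carrier := P\<rparr>) chi q"
  let ?F = "\<lambda>(p, a). p \<oplus> [(a::int)] \<cdot> g"
  have modg: "[(k mod int q)] \<cdot> g = [k] \<cdot> g" for k
    by (simp add: g(3)[rule_format])
  have memH: "[k] \<cdot> g \<in> H" for k :: int
    using H_memI[of "[k] \<cdot> g"] H_torsion[OF g(1)] gA
    by (metis add.int_pow_closed add.int_pow_pow add.int_pow_one mult.commute)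
  have surj: "?F ` carrier ?E = carrier A"
  proof
    show "?F ` carrier ?E \<subseteq> carrier A"
      using P_carrier gA by auto
    show "carrier A \<subseteq> ?F ` carrier ?E"
    proof
      fix x assume x: "x \<in> carrier A"
      obtain p h where ph: "p \<in> P" "h \<in> H" "x = p \<oplus> h" by (rule sum_cases[OF x])
      obtain k where "k \<in> {0..int q - 1}" "h = [k] \<cdot> g" using g(2) ph by blast
      then show "x \<in> ?F ` carrier ?E" using ph by (intro image_eqI[of _ _ "(p, k)"]) auto
    qed
  qed
  have "card (carrier ?E) = card (?F ` carrier ?E)"
    using surj order_A P(2) by (simp add: card_cartesian_product order_def)
  moreover have "finite (carrier ?E)" using finite_P by simp
  ultimately have "bij_betw ?F (carrier ?E) (carrier A)"
    using surj by (auto simp: bij_betw_def intro: eq_card_imp_inj_on)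
  moreover have "?F (u \<oplus>\<^bsub>?E\<^esub> v) = ?F u \<oplus> ?F v" if "u \<in> carrier ?E" "v \<in> carrier ?E" for u v
    using that P_carrier gA by (cases u; cases v) (simp add: modg add.int_pow_mult a_ac)
  moreover have "?F (u \<otimes>\<^bsub>?E\<^esub> v) = ?F u \<otimes> ?F v" if "u \<in> carrier ?E" "v \<in> carrier ?E" for u v
  proof -
    obtain p a p' a' where uv: "u = (p, a)" "v = (p', a')" by (metis surj_pair)
    have pp: "p \<in> P" "p' \<in> P" using that uv by auto
    have c: "p \<in> carrier A" "p' \<in> carrier A" using pp P_carrier by auto
    have "?F u \<otimes> ?F v = p \<otimes> (p' \<oplus> [a'] \<cdot> g)"
      using uv sum_mult[OF pp(1) memH] c gA by simp
    also have "\<dots> = p \<otimes> p' \<oplus> [((chi p - 1) * a')] \<cdot> g"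
      using c gA pp by (simp add: left_distrib mult_add_pow chi add.int_pow_pow)
    finally show ?thesis using uv by (simp add: modg)
  qed
  ultimately have "brace_isomorphic ?E A"
    unfolding brace_isomorphic_def by blast
  with char show thesis by (rule that)
qed

end

text \<open>Sylow's theorem supplies mere additive subgroups; their description by torsion is what
  turns \<open>P\<close> into a sub-brace.\<close>

lemma (in left_brace) isomorphic_extension_of_order_4:
  assumes "prime q" "q > 3" "order A = 4 * q"
  obtains P chi where "left_brace (A\<lparr>carrier := P\<rparr>)" "card P = 4"
    "brace_character (A\<lparr>carrier := P\<rparr>) chi q"
    "brace_isomorphic (brace_extension (A\<lparr>carrier := P\<rparr>) chi q) A"
proof -
  have o: "order (add_monoid A) = 4 * q" using assms(3) by (simp add: order_def)
  obtain P where P: "subgroup P (add_monoid A)" "card P = 2 ^ 2"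
    using sylow_thm[of 2 "add_monoid A" 2 q] o a_group finite_carrier by auto
  obtain H where H: "subgroup H (add_monoid A)" "card H = q ^ 1"
    using sylow_thm[of q "add_monoid A" 1 4] o a_group finite_carrier assms(1) by auto
  interpret brace_4q A q P H
    by (intro brace_4q.intro brace_4q_axioms.intro left_brace_axioms) (use P H assms in simp_all)
  have "left_brace (A\<lparr>carrier := P\<rparr>)"
    by (rule left_brace_subset[OF P(1)]) (simp add: mult_P P_carrier)
  moreover obtain chi where "brace_character (A\<lparr>carrier := P\<rparr>) chi q"
    "brace_isomorphic (brace_extension (A\<lparr>carrier := P\<rparr>) chi q) A"
    by (rule isomorphic_extension)
  ultimately show thesis
    using that[of P chi] P(2) by simp
qed

section \<open>Extensions by characters, and invariants\<close>

lemma brace_isomorphic_sym: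
  assumes "left_brace A" "brace_isomorphic A B"
  shows "brace_isomorphic B A"
proof -
  interpret left_brace A by fact
  obtain f where f: "bij_betw f (carrier A) (carrier B)"
    "\<And>x y. \<lbrakk>x \<in> carrier A; y \<in> carrier A\<rbrakk> \<Longrightarrow> f (x \<oplus>\<^bsub>A\<^esub> y) = f x \<oplus>\<^bsub>B\<^esub> f y"
    "\<And>x y. \<lbrakk>x \<in> carrier A; y \<in> carrier A\<rbrakk> \<Longrightarrow> f (x \<otimes>\<^bsub>A\<^esub> y) = f x \<otimes>\<^bsub>B\<^esub> f y"
    using assms(2) unfolding brace_isomorphic_def by blast
  define g where "g = the_inv_into (carrier A) f"
  have inj: "inj_on f (carrier A)" and img: "f ` carrier A = carrier B"
    using f(1) by (simp_all add: bij_betw_def)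
  have gf: "g (f x) = x" if "x \<in> carrier A" for x
    using that inj by (simp add: g_def the_inv_into_f_f)
  have "bij_betw g (carrier B) (carrier A)"
    unfolding g_def by (rule bij_betw_the_inv_into[OF f(1)])
  moreover have "g (x \<oplus>\<^bsub>B\<^esub> y) = g x \<oplus>\<^bsub>A\<^esub> g y \<and> g (x \<otimes>\<^bsub>B\<^esub> y) = g x \<otimes>\<^bsub>A\<^esub> g y"
    if xy: "x \<in> carrier B" "y \<in> carrier B" for x y
  proof -
    obtain x' y' where xy': "x' \<in> carrier A" "x = f x'" "y' \<in> carrier A" "y = f y'"
      using xy img by blast
    \<comment> \<open>Closure of \<open>A\<close> lets \<open>g\<close> undo \<open>f\<close> at
      sums and products.\<close>
    then show ?thesis by (simp add: gf flip: f(2,3))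
  qed
  ultimately show ?thesis
    unfolding brace_isomorphic_def by blast
qed

lemma brace_isomorphic_trans [trans]:
  assumes "brace_isomorphic A B" "brace_isomorphic B C"
  shows "brace_isomorphic A C"
proof -
  obtain f where f: "bij_betw f (carrier A) (carrier B)"
    "\<forall>x\<in>carrier A. \<forall>y\<in>carrier A. f (x \<oplus>\<^bsub>A\<^esub> y) = f x \<oplus>\<^bsub>B\<^esub> f y"
    "\<forall>x\<in>carrier A. \<forall>y\<in>carrier A. f (x \<otimes>\<^bsub>A\<^esub> y) = f x \<otimes>\<^bsub>B\<^esub> f y"
    using assms(1) unfolding brace_isomorphic_def by blast
  obtain g where g: "bij_betw g (carrier B) (carrier C)"
    "\<forall>x\<in>carrier B. \<forall>y\<in>carrier B. g (x \<oplus>\<^bsub>B\<^esub> y) = g x \<oplus>\<^bsub>C\<^esub> g y"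
    "\<forall>x\<in>carrier B. \<forall>y\<in>carrier B. g (x \<otimes>\<^bsub>B\<^esub> y) = g x \<otimes>\<^bsub>C\<^esub> g y"
    using assms(2) unfolding brace_isomorphic_def by blast
  have "f x \<in> carrier B" if "x \<in> carrier A" for x
    using f(1) that by (auto simp: bij_betw_def)
  then show ?thesis
    unfolding brace_isomorphic_def
    using bij_betw_trans[OF f(1) g(1)] f(2,3) g(2,3)
    by (intro exI[of _ "g \<circ> f"]) simp
qed

text \<open>The second coordinate can stay fixed: automorphisms of the integers modulo
  \<open>q\<close> are scalars and commute with the action, so only isomorphisms of the first factor
  can move a character.\<close>

lemma brace_extension_isomorphic:
  assumes f: "bij_betw f (carrier P) (carrier P')"
    "\<And>x y. \<lbrakk>x \<in> carrier P; y \<in> carrier P\<rbrakk> \<Longrightarrow> f (x \<oplus>\<^bsub>P\<^esub> y) = f x \<oplus>\<^bsub>P'\<^esub> f y"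
    "\<And>x y. \<lbrakk>x \<in> carrier P; y \<in> carrier P\<rbrakk> \<Longrightarrow> f (x \<otimes>\<^bsub>P\<^esub> y) = f x \<otimes>\<^bsub>P'\<^esub> f y"
    and chi: "\<And>x. x \<in> carrier P \<Longrightarrow> [chi' (f x) = chi x] (mod int q)"
  shows "brace_isomorphic (brace_extension P chi q) (brace_extension P' chi' q)"
proof -
  let ?F = "map_prod f id"
  have "((chi' (f x) - 1) * b) mod int q = ((chi x - 1) * b) mod int q" if "x \<in> carrier P" for x b
    using chi[OF that] unfolding cong_def[symmetric] by (intro cong_mult cong_diff) auto
  then show ?thesis
    unfolding brace_isomorphic_def
    using f bij_betw_map_prod[OF f(1) bij_betw_id[of "{0..int q - 1}"]]
    by (intro exI[of _ ?F]) auto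
qed

lemma left_brace_extension:
  fixes P (structure)
  assumes P: "left_brace P" and chi: "brace_character P chi q" and q: "q > 1"
  shows "left_brace (brace_extension P chi q)"
proof -
  interpret left_brace P by fact
  let ?E = "brace_extension P chi q"
  interpret R: residues "int q" "residue_ring (int q)"
    by unfold_locales (use q in auto)
  \<comment> \<open>\<open>P\<close> is not a ring in general, so the abelian group comes from the
    product of the additive groups instead of the direct product of rings.\<close>
  have "comm_group (add_monoid P \<times>\<times> add_monoid (residue_ring (int q)))"
    by (rule group.group_comm_groupI[OF DirProd_group[OF a_group R.a_group]])
      (auto simp: a_comm R.a_comm)
  moreover have "add_monoid ?E = add_monoid P \<times>\<times> add_monoid (residue_ring (int q))"
    by (simp add: brace_extension_def RDirProd_def DirProd_def monoid.defs)
  ultimately have ab: "abelian_group ?E"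
    by (intro comm_group_abelian_groupI) simp
  have inj: "inj_on (\<lambda>u. x \<otimes>\<^bsub>?E\<^esub> u \<oplus>\<^bsub>?E\<^esub> u) (carrier ?E)" if x: "x \<in> carrier ?E" for x
  proof (rule inj_onI)
    obtain p a where pa: "x = (p, a)" "p \<in> carrier P" using x by auto
    fix u v
    assume uv: "u \<in> carrier ?E" "v \<in> carrier ?E"
      "x \<otimes>\<^bsub>?E\<^esub> u \<oplus>\<^bsub>?E\<^esub> u = x \<otimes>\<^bsub>?E\<^esub> v \<oplus>\<^bsub>?E\<^esub> v"
    obtain s b t c where st: "u = (s, b)" "v = (t, c)" by (metis surj_pair)
    have c: "s \<in> carrier P" "t \<in> carrier P" "0 \<le> b" "b < int q" "0 \<le> c" "c < int q"
      using uv st by auto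
    have "lam p s = lam p t" using uv(3) pa st by (simp add: lam_def)
    then have "s = t" using lam_inj pa c by blast
    \<comment> \<open>The character value at the circle inverse \<open>p'\<close> inverts
      \<open>chi p\<close> modulo \<open>q\<close>, which makes the second coordinate
      cancellable.\<close>
    obtain p' where p': "p' \<in> carrier P" "p' \<otimes> p \<oplus> p' \<oplus> p = \<zero>"
      using group.l_inv_ex[OF group_circle, of p] pa by (auto simp: circle_group_def)
    have "[chi p' * chi p = chi (p' \<otimes> p \<oplus> p' \<oplus> p)] (mod int q)"
      using chi p'(1) pa(2) unfolding brace_character_def by (blast intro: cong_sym)
    also have "[chi (p' \<otimes> p \<oplus> p' \<oplus> p) = 1] (mod int q)"
      using chi p' by (simp add: brace_character_def)
    finally have unit: "[chi p' * chi p = 1] (mod int q)" .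
    have "[(chi p - 1) * b + b = (chi p - 1) * c + c] (mod int q)"
      using uv(3) pa st by (simp add: cong_def mod_simps)
    then have "[chi p' * ((chi p - 1) * b + b) = chi p' * ((chi p - 1) * c + c)] (mod int q)"
      by (rule cong_scalar_left)
    then have "[(chi p' * chi p) * b = (chi p' * chi p) * c] (mod int q)"
      by (simp add: algebra_simps)
    moreover have "[(chi p' * chi p) * d = 1 * d] (mod int q)" for d
      by (rule cong_scalar_right[OF unit])
    ultimately have "[b = c] (mod int q)"
      by (metis cong_sym cong_trans mult_1)
    then have "b = c" using c by (simp add: cong_def)
    with \<open>s = t\<close> show "u = v" using st by simp
  qed
  show ?thesis
  proof (intro left_brace.intro ab left_brace_axioms.intro)
    show fin: "finite (carrier ?E)" using finite_carrier by simp
    show clo: "x \<otimes>\<^bsub>?E\<^esub> y \<in> carrier ?E" if "x \<in> carrier ?E" "y \<in> carrier ?E" for x y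
      using that q by (cases x; cases y) simp
    show "bij_betw (\<lambda>u. x \<otimes>\<^bsub>?E\<^esub> u \<oplus>\<^bsub>?E\<^esub> u) (carrier ?E) (carrier ?E)" if x: "x \<in> carrier ?E" for x
      unfolding bij_betw_def
      using inj[OF x] clo[OF x] by (intro conjI endo_inj_surj[OF fin]) (auto intro!: abelian_groupE(1)[OF ab] simp del: brace_extension_simps)
    fix x y z
    assume "x \<in> carrier ?E" "y \<in> carrier ?E" "z \<in> carrier ?E"
    then obtain p a s b t c where *: "x = (p, a)" "y = (s, b)" "z = (t, c)"
      "p \<in> carrier P" "s \<in> carrier P" "t \<in> carrier P" by auto
    show "x \<otimes>\<^bsub>?E\<^esub> (y \<oplus>\<^bsub>?E\<^esub> z) = x \<otimes>\<^bsub>?E\<^esub> y \<oplus>\<^bsub>?E\<^esub> x \<otimes>\<^bsub>?E\<^esub> z"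
      using * by (simp add: left_distrib mod_simps distrib_left)
    have "[chi (p \<otimes> s \<oplus> p \<oplus> s) = chi p * chi s] (mod int q)"
      using chi * by (simp add: brace_character_def)
    then have "[(chi (p \<otimes> s \<oplus> p \<oplus> s) - 1) * c = (chi p * chi s - 1) * c] (mod int q)"
      by (intro cong_mult cong_diff) auto
    then have "(chi (p \<otimes> s \<oplus> p \<oplus> s) - 1) * c mod int q
       = ((chi p - 1) * ((chi s - 1) * c) + (chi p - 1) * c + (chi s - 1) * c) mod int q"
      by (simp add: cong_def algebra_simps)
    then show "(x \<otimes>\<^bsub>?E\<^esub> y \<oplus>\<^bsub>?E\<^esub> x \<oplus>\<^bsub>?E\<^esub> y) \<otimes>\<^bsub>?E\<^esub> z
        = x \<otimes>\<^bsub>?E\<^esub> (y \<otimes>\<^bsub>?E\<^esub> z) \<oplus>\<^bsub>?E\<^esub> x \<otimes>\<^bsub>?E\<^esub> z \<oplus>\<^bsub>?E\<^esub> y \<otimes>\<^bsub>?E\<^esub> z"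
      using * by (simp add: circle_action mod_simps)
  qed
qed

text \<open>
  In a brace of order \<open>4q\<close>, the elements killed by \<open>quadruple\<close> are those of the Sylow subgroup of
  order \<open>4\<close>, and \<open>quadruple\<close> itself kills exactly the component in that subgroup.
\<close>

definition quadruple :: "('a, 'm) ring_scheme \<Rightarrow> 'a \<Rightarrow> 'a"
  where "quadruple A x = (x \<oplus>\<^bsub>A\<^esub> x) \<oplus>\<^bsub>A\<^esub> (x \<oplus>\<^bsub>A\<^esub> x)"

text \<open>Only sums, products and zero occur, so isomorphism invariance is formal. The first two
  components determine the brace of order 4. The third tests whether the character is trivial; the
  fourth and fifth test it on doubles, which matters over a cyclic additive group, and on products,
  which matters over a nontrivial multiplication.\<close>

definition brace_signature :: "('a, 'm) ring_scheme \<Rightarrow> bool \<times> bool \<times> bool \<times> bool \<times> bool"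
  where "brace_signature A =
   (\<forall>x \<in> carrier A. quadruple A x = \<zero>\<^bsub>A\<^esub> \<longrightarrow> x \<oplus>\<^bsub>A\<^esub> x = \<zero>\<^bsub>A\<^esub>,
    \<forall>x \<in> carrier A. \<forall>y \<in> carrier A. quadruple A y = \<zero>\<^bsub>A\<^esub> \<longrightarrow> x \<otimes>\<^bsub>A\<^esub> y = \<zero>\<^bsub>A\<^esub>,
    \<forall>x \<in> carrier A. \<forall>y \<in> carrier A. quadruple A (x \<otimes>\<^bsub>A\<^esub> y) = \<zero>\<^bsub>A\<^esub>,
    \<forall>x \<in> carrier A. \<forall>y \<in> carrier A. quadruple A ((x \<oplus>\<^bsub>A\<^esub> x) \<otimes>\<^bsub>A\<^esub> y) = \<zero>\<^bsub>A\<^esub>,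
    \<forall>x \<in> carrier A. \<forall>y \<in> carrier A. \<forall>z \<in> carrier A.
      quadruple A ((x \<otimes>\<^bsub>A\<^esub> y) \<otimes>\<^bsub>A\<^esub> z) = \<zero>\<^bsub>A\<^esub>)"

lemma brace_signature_isomorphic:
  assumes A: "left_brace A" and B: "left_brace B" and iso: "brace_isomorphic A B"
  shows "brace_signature A = brace_signature B"
proof -
  interpret A: left_brace A by fact
  interpret B: left_brace B by fact
  obtain f where f: "bij_betw f (carrier A) (carrier B)"
    "\<forall>x\<in>carrier A. \<forall>y\<in>carrier A. f (x \<oplus>\<^bsub>A\<^esub> y) = f x \<oplus>\<^bsub>B\<^esub> f y"
    "\<forall>x\<in>carrier A. \<forall>y\<in>carrier A. f (x \<otimes>\<^bsub>A\<^esub> y) = f x \<otimes>\<^bsub>B\<^esub> f y"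
    using iso unfolding brace_isomorphic_def by blast
  have carB: "carrier B = f ` carrier A"
    using f(1) by (simp add: bij_betw_def)
  have fc: "f x \<in> carrier B" if "x \<in> carrier A" for x
    using that carB by simp
  have f0: "f \<zero>\<^bsub>A\<^esub> = \<zero>\<^bsub>B\<^esub>"
    using f(2)[rule_format, of "\<zero>\<^bsub>A\<^esub>" "\<zero>\<^bsub>A\<^esub>"] fc[of "\<zero>\<^bsub>A\<^esub>"]
    by (metis A.r_zero A.zero_closed B.add.r_cancel_one')
  have zero_iff: "f x = \<zero>\<^bsub>B\<^esub> \<longleftrightarrow> x = \<zero>\<^bsub>A\<^esub>" if "x \<in> carrier A" for x
    using f(1) f0 that by (metis A.zero_closed bij_betw_def inj_on_eq_iff)
  have quad: "quadruple B (f x) = f (quadruple A x)" if "x \<in> carrier A" for x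
    using that f(2) by (simp add: quadruple_def)
  have [simp]: "quadruple A x \<in> carrier A" if "x \<in> carrier A" for x
    using that by (simp add: quadruple_def)
  show ?thesis
    unfolding brace_signature_def carB
    by (simp add: quad zero_iff flip: f(2)[rule_format] f(3)[rule_format])
qed

text \<open>Here \<open>quadruple\<close> vanishes on \<open>P\<close> and is invertible on the
  second factor, as 4 is a unit modulo the odd number \<open>q\<close>. Each component therefore
  collapses to a condition on \<open>P\<close> or on \<open>chi\<close> alone.\<close>

lemma brace_signature_extension:
  assumes P: "left_brace P" and exponent: "\<And>x. x \<in> carrier P \<Longrightarrow> quadruple P x = \<zero>\<^bsub>P\<^esub>"
    and q: "odd q" "q > 1"
  shows "brace_signature (brace_extension P chi q) =
   (\<forall>x \<in> carrier P. x \<oplus>\<^bsub>P\<^esub> x = \<zero>\<^bsub>P\<^esub>,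
    \<forall>x \<in> carrier P. \<forall>y \<in> carrier P. x \<otimes>\<^bsub>P\<^esub> y = \<zero>\<^bsub>P\<^esub>,
    \<forall>x \<in> carrier P. [chi x = 1] (mod int q),
    \<forall>x \<in> carrier P. [chi (x \<oplus>\<^bsub>P\<^esub> x) = 1] (mod int q),
    \<forall>x \<in> carrier P. \<forall>y \<in> carrier P. [chi (x \<otimes>\<^bsub>P\<^esub> y) = 1] (mod int q))"
proof -
  interpret left_brace P by fact
  let ?E = "brace_extension P chi q"
  let ?Z = "{0..int q - 1}"
  have cop: "coprime 4 (int q)"
    using q(1) coprime_power_left_iff[of 2 2 "int q"] by simp
  have four: "(4 * k) mod int q = 0 \<longleftrightarrow> k mod int q = 0" for k
    using cop by (simp add: mod_eq_0_iff_dvd coprime_commute coprime_dvd_mult_right_iff)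
  have quad: "quadruple ?E (x, a) = (\<zero>\<^bsub>P\<^esub>, 0) \<longleftrightarrow> a mod int q = 0" if "x \<in> carrier P" for x a
    using exponent[OF that] four[of a] by (simp add: quadruple_def mod_simps)
  have chi1: "(\<forall>a\<in>?Z. ((c - 1) * a) mod int q = 0) \<longleftrightarrow> [c = 1] (mod int q)" for c
  proof
    assume "\<forall>a\<in>?Z. ((c - 1) * a) mod int q = 0"
    then show "[c = 1] (mod int q)"
      using q(2) by (force dest: bspec[of _ _ 1] simp: cong_iff_dvd_diff)
  qed (auto simp: cong_iff_dvd_diff)
  have ne: "\<exists>y\<ge>0. y < int q"
    using q(2) by (intro exI[of _ 0]) simp
  have zero: "0 \<in> ?Z" "a \<in> ?Z \<Longrightarrow> a mod int q = 0 \<longleftrightarrow> a = 0" for a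
    using q(2) by auto
  have zero_mod: "(\<forall>a\<in>?Z. a mod int q = 0 \<longrightarrow> R a) \<longleftrightarrow> R 0" for R
    using zero by auto
  have 1: "(\<forall>x \<in> carrier ?E. quadruple ?E x = \<zero>\<^bsub>?E\<^esub> \<longrightarrow> x \<oplus>\<^bsub>?E\<^esub> x = \<zero>\<^bsub>?E\<^esub>) \<longleftrightarrow>
      (\<forall>x \<in> carrier P. x \<oplus>\<^bsub>P\<^esub> x = \<zero>\<^bsub>P\<^esub>)"
    using zero_mod by (simp add: quad split_paired_Ball_Sigma ball_conj_distrib)
  have 2: "(\<forall>x \<in> carrier ?E. \<forall>y \<in> carrier ?E. quadruple ?E y = \<zero>\<^bsub>?E\<^esub> \<longrightarrow> x \<otimes>\<^bsub>?E\<^esub> y = \<zero>\<^bsub>?E\<^esub>)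
     \<longleftrightarrow> (\<forall>x \<in> carrier P. \<forall>y \<in> carrier P. x \<otimes>\<^bsub>P\<^esub> y = \<zero>\<^bsub>P\<^esub>)"
    using zero_mod ne by (simp add: quad split_paired_Ball_Sigma)
  have 3: "(\<forall>x \<in> carrier ?E. \<forall>y \<in> carrier ?E. quadruple ?E (x \<otimes>\<^bsub>?E\<^esub> y) = \<zero>\<^bsub>?E\<^esub>)
     \<longleftrightarrow> (\<forall>x \<in> carrier P. [chi x = 1] (mod int q))"
    using ne by (auto simp: quad split_paired_Ball_Sigma chi1)
  have 4: "(\<forall>x \<in> carrier ?E. \<forall>y \<in> carrier ?E. quadruple ?E ((x \<oplus>\<^bsub>?E\<^esub> x) \<otimes>\<^bsub>?E\<^esub> y) = \<zero>\<^bsub>?E\<^esub>)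
     \<longleftrightarrow> (\<forall>x \<in> carrier P. [chi (x \<oplus>\<^bsub>P\<^esub> x) = 1] (mod int q))"
    using ne by (auto simp: quad split_paired_Ball_Sigma chi1)
  have 5: "(\<forall>x \<in> carrier ?E. \<forall>y \<in> carrier ?E. \<forall>z \<in> carrier ?E.
        quadruple ?E ((x \<otimes>\<^bsub>?E\<^esub> y) \<otimes>\<^bsub>?E\<^esub> z) = \<zero>\<^bsub>?E\<^esub>)
     \<longleftrightarrow> (\<forall>x \<in> carrier P. \<forall>y \<in> carrier P. [chi (x \<otimes>\<^bsub>P\<^esub> y) = 1] (mod int q))"
    using ne by (auto simp: quad split_paired_Ball_Sigma chi1)
  show ?thesis
    unfolding brace_signature_def 1 2 3 4 5 ..
qed

section \<open>Braces of order 4\<close>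

definition trivial_brace_22 :: "(int \<times> int) ring"
  where "trivial_brace_22 = (RDirProd (residue_ring 2) (residue_ring 2))
    \<lparr>monoid.mult := \<lambda>_ _. (0, 0)\<rparr>"

definition trivial_brace_4 :: "int ring"
  where "trivial_brace_4 = (residue_ring 4)\<lparr>monoid.mult := \<lambda>_ _. 0\<rparr>"

definition nontrivial_brace_22 :: "(int \<times> int) ring"
  where "nontrivial_brace_22 = (RDirProd (residue_ring 2) (residue_ring 2))
    \<lparr>monoid.mult := \<lambda>(x1, y1) (x2, y2). ((y1 * y2) mod 2, 0)\<rparr>"

definition nontrivial_brace_4 :: "int ring"
  where "nontrivial_brace_4 = (residue_ring 4)\<lparr>monoid.mult := \<lambda>u1 u2. (2 * u1 * u2) mod 4\<rparr>"

lemma residue_carriers_of_order_4: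
  "{0..2 - 1::int} \<times> {0..2 - 1::int} = {(0, 0), (0, 1), (1, 0), (1, 1)}"
  "{0..4 - 1::int} = {0, 1, 2, 3}"
  by (auto simp: set_eq_iff)

lemma brace_22_simps [simp]:
  "carrier trivial_brace_22 = {(0, 0), (0, 1), (1, 0), (1, 1)}"
  "carrier nontrivial_brace_22 = {(0, 0), (0, 1), (1, 0), (1, 1)}"
  "(x, y) \<oplus>\<^bsub>trivial_brace_22\<^esub> (x', y') = ((x + x') mod 2, (y + y') mod 2)"
  "(x, y) \<oplus>\<^bsub>nontrivial_brace_22\<^esub> (x', y') = ((x + x') mod 2, (y + y') mod 2)"
  "u \<otimes>\<^bsub>trivial_brace_22\<^esub> v = (0, 0)"
  "(x, y) \<otimes>\<^bsub>nontrivial_brace_22\<^esub> (x', y') = ((y * y') mod 2, 0)"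
  "\<zero>\<^bsub>trivial_brace_22\<^esub> = (0, 0)"
  "\<zero>\<^bsub>nontrivial_brace_22\<^esub> = (0, 0)"
  unfolding trivial_brace_22_def nontrivial_brace_22_def RDirProd_def DirProd_def
    residue_ring_def monoid.defs
  using residue_carriers_of_order_4(1) by simp_all

lemma brace_4_simps [simp]:
  "carrier trivial_brace_4 = {0, 1, 2, 3}"
  "carrier nontrivial_brace_4 = {0, 1, 2, 3}"
  "i \<oplus>\<^bsub>trivial_brace_4\<^esub> j = (i + j) mod 4"
  "i \<oplus>\<^bsub>nontrivial_brace_4\<^esub> j = (i + j) mod 4"
  "i \<otimes>\<^bsub>trivial_brace_4\<^esub> j = 0"
  "i \<otimes>\<^bsub>nontrivial_brace_4\<^esub> j = (2 * i * j) mod 4"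
  "\<zero>\<^bsub>trivial_brace_4\<^esub> = 0"
  "\<zero>\<^bsub>nontrivial_brace_4\<^esub> = 0"
  unfolding trivial_brace_4_def nontrivial_brace_4_def residue_ring_def
  using residue_carriers_of_order_4(2) by simp_all

lemma abelian_group_update_mult:
  "abelian_group R \<Longrightarrow> abelian_group (R\<lparr>monoid.mult := f\<rparr>)"
  by (intro comm_group_abelian_groupI) (simp add: abelian_group.a_comm_group)

lemma left_brace_order_4:
  "left_brace trivial_brace_22" "left_brace trivial_brace_4"
  "left_brace nontrivial_brace_22" "left_brace nontrivial_brace_4"
proof -
  interpret R2: residues 2 "residue_ring 2" by unfold_locales auto
  interpret R4: residues 4 "residue_ring 4" by unfold_locales auto
  interpret R22: ring "RDirProd (residue_ring 2) (residue_ring 2)"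
    by (intro RDirProd_ring cring.axioms(1)[OF R2.cring])
  have ab: "abelian_group trivial_brace_22" "abelian_group trivial_brace_4"
    "abelian_group nontrivial_brace_22" "abelian_group nontrivial_brace_4"
    unfolding trivial_brace_22_def trivial_brace_4_def nontrivial_brace_22_def nontrivial_brace_4_def
    by (intro abelian_group_update_mult R22.abelian_group_axioms R4.abelian_group_axioms)+
  show "left_brace trivial_brace_22"
    by (intro left_brace.intro ab left_brace_axioms.intro)
      (auto simp: bij_betw_def inj_on_def image_def)
  show "left_brace trivial_brace_4"
    by (intro left_brace.intro ab left_brace_axioms.intro)
      (auto simp: bij_betw_def inj_on_def image_def)
  show "left_brace nontrivial_brace_22"
    by (intro left_brace.intro ab left_brace_axioms.intro)
      (auto simp: bij_betw_def inj_on_def image_def)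
  show "left_brace nontrivial_brace_4"
    by (intro left_brace.intro ab left_brace_axioms.intro)
      (auto simp: bij_betw_def inj_on_def image_def)
qed

text \<open>These are equalities of records, not just isomorphisms: the models update the same
  residue rings, and the product multiplication in which they could differ is overwritten on both
  sides.\<close>

lemma named_brace_eq_extension:
  "brace_T22 q w m = brace_extension trivial_brace_22 (\<lambda>(x, y). w ^ nat x * m ^ nat y) q"
  "brace_T4 q w = brace_extension trivial_brace_4 (\<lambda>x. w ^ nat x) q"
  "brace_B22 q w = brace_extension nontrivial_brace_22 (\<lambda>(x, y). w ^ nat (2 * x + y)) q"
  "brace_B4 q w m =
     brace_extension nontrivial_brace_4 (\<lambda>u. w ^ nat (u div 2) * m ^ nat (u mod 2)) q"
  by (auto simp: brace_T22_def brace_T4_def brace_B22_def brace_B4_def brace_extension_def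
    trivial_brace_22_def trivial_brace_4_def nontrivial_brace_22_def nontrivial_brace_4_def
    RDirProd_def DirProd_def monoid.defs residue_ring_def fun_eq_iff)

section \<open>The possible multiplications on the two groups of order 4\<close>

context left_brace
begin

lemma quadruple_order_4: "\<lbrakk>order A = 4; x \<in> carrier A\<rbrakk> \<Longrightarrow> quadruple A x = \<zero>"
  using add.pow_order_eq_1[of x]
  by (simp add: order_def quadruple_def numeral_eq_Suc a_assoc)

text \<open>Since \<open>x\<close> generates the additive group, \<open>a\<close> acts through
  \<open>a \<otimes> x\<close> alone. The automorphism \<open>lam a\<close> sends \<open>x\<close>
  to itself or to \<open>z\<close>, its negative, so \<open>a \<otimes> x\<close> is
  \<open>\<zero>\<close> or \<open>y\<close>. The circle law then determines
  \<open>y \<otimes> x\<close> and \<open>z \<otimes> x\<close> from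
  \<open>x \<otimes> x\<close>.\<close>

lemma isomorphic_cyclic_order_4:
  assumes card: "order A = 4" and x: "x \<in> carrier A" "x \<oplus> x \<noteq> \<zero>"
  shows "brace_isomorphic A trivial_brace_4 \<or> brace_isomorphic A nontrivial_brace_4"
proof -
  define y where "y = x \<oplus> x"
  define z where "z = x \<oplus> y"
  have c: "y \<in> carrier A" "z \<in> carrier A" using x by (simp_all add: y_def z_def)
  have xx: "x \<oplus> x = y" and xy: "x \<oplus> y = z" by (simp_all add: y_def z_def)
  have yx: "y \<oplus> x = z" using xy x c by (simp add: a_comm)
  have yy: "y \<oplus> y = \<zero>"
    using quadruple_order_4[OF card x(1)] by (simp add: quadruple_def y_def)
  have xz: "x \<oplus> z = \<zero>" using yy x c by (simp add: xy[symmetric] a_assoc[symmetric] xx)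
  have zx: "z \<oplus> x = \<zero>" using xz x c by (simp add: a_comm)
  have yz: "y \<oplus> z = x" using x c by (simp add: yx[symmetric] a_assoc[symmetric] yy)
  have zy: "z \<oplus> y = x" using yz x c by (simp add: a_comm)
  have zz: "z \<oplus> z = y" using x c by (simp add: yx[symmetric] a_assoc xz zx) (simp add: yx xz)
  note table = xx xy yx yy xz zx yz zy zz
  have y0: "y \<noteq> \<zero>" using x by (simp add: y_def)
  have x0: "x \<noteq> \<zero>" using y0 xx by auto
  have ne: "x \<noteq> y" "x \<noteq> z" "y \<noteq> z" "z \<noteq> \<zero>"
    using table x0 y0 x c by (metis l_zero r_zero)+
  note ne = ne x0 y0 ne[symmetric] x0[symmetric] y0[symmetric]
  have carA: "carrier A = {\<zero>, x, y, z}"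
    by (rule card_subset_eq[OF finite_carrier, symmetric])
      (use x c ne card in \<open>auto simp: order_def\<close>)
  have mult_y: "a \<otimes> y = a \<otimes> x \<oplus> a \<otimes> x" and mult_z: "a \<otimes> z = a \<otimes> x \<oplus> a \<otimes> y"
    if "a \<in> carrier A" for a
    using that x c left_distrib[of a x x] left_distrib[of a x y] by (simp_all add: xx xy)
  have cases: "a \<otimes> x = \<zero> \<or> a \<otimes> x = y" if a: "a \<in> carrier A" for a
  proof (rule ccontr)
    assume "\<not> ?thesis"
    then have "a \<otimes> x = x \<or> a \<otimes> x = z"
      using mult_closed[OF a x(1)] carA by auto
    then show False
    proof
      assume *: "a \<otimes> x = x"
      have "lam a y = lam a \<zero>" using a c by (simp add: lam_def mult_y * table)
      then show False using lam_inj[OF a c(1) zero_closed] y0 by simp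
    next
      assume *: "a \<otimes> x = z"
      have "lam a x = lam a \<zero>" using a x by (simp add: lam_def * table)
      then show False using lam_inj[OF a x(1) zero_closed] x0 by simp
    qed
  qed
  have circ: "c' \<otimes> x = a \<otimes> (b \<otimes> x) \<oplus> a \<otimes> x \<oplus> b \<otimes> x"
    if "a \<in> carrier A" "b \<in> carrier A" "a \<otimes> b \<oplus> a \<oplus> b = c'" for a b c'
    using circle_action[of a b x] that x by simp
  define f :: "'a \<Rightarrow> int" where
    "f u = (if u = \<zero> then 0 else if u = x then 1 else if u = y then 2 else 3)" for u
  have f: "f \<zero> = 0" "f x = 1" "f y = 2" "f z = 3"
    using ne by (simp_all add: f_def)
  have bij: "bij_betw f (carrier A) {0, 1, 2, 3}"
    unfolding carA bij_betw_def by (auto simp: inj_on_def f)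
  show ?thesis
  proof (cases "x \<otimes> x = \<zero>")
    case True
    have 1: "y \<otimes> x = \<zero>" using circ[of x x y] True x c by (simp add: table)
    have 2: "z \<otimes> x = \<zero>" using circ[of x y z] True 1 x c by (simp add: mult_y table)
    have "\<forall>a\<in>carrier A. \<forall>b\<in>carrier A. a \<otimes> b = \<zero>"
      unfolding carA using x c by (auto simp: mult_y mult_z True 1 2)
    then have "brace_isomorphic A trivial_brace_4"
      unfolding brace_isomorphic_def
      using bij x c by (intro exI[of _ f]) (simp add: carA table f)
    then show ?thesis ..
  next
    case False
    then have xmx: "x \<otimes> x = y" using cases x by blast
    have zmx: "z \<otimes> x = x \<otimes> (y \<otimes> x) \<oplus> y \<oplus> y \<otimes> x"
      using circ[of x y z] x c by (simp add: mult_y table xmx)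
    \<comment> \<open>If \<open>y \<otimes> x = y\<close>, then
      \<open>z \<otimes> x = \<zero>\<close>, so \<open>lam z\<close> is trivial; but
      \<open>y\<close> is the circle square of \<open>z\<close>, so \<open>lam y\<close> would be
      trivial too.\<close>
    have ymx: "y \<otimes> x = \<zero>"
    proof (rule ccontr)
      assume "y \<otimes> x \<noteq> \<zero>"
      then have *: "y \<otimes> x = y" using cases c by blast
      have "z \<otimes> x = \<zero>" unfolding zmx * using x c by (simp add: mult_y table xmx)
      then have "y \<otimes> x = \<zero>"
        using circ[of z z y] x c by (simp add: mult_y mult_z table)
      with * y0 show False by simp
    qed
    have "z \<otimes> x = y" unfolding zmx ymx using x c by simp
    note mt = xmx ymx this
    have "brace_isomorphic A nontrivial_brace_4"
      unfolding brace_isomorphic_def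
      using bij x c by (intro exI[of _ f]) (simp add: carA table f mult_y mult_z mt)
    then show ?thesis ..
  qed
qed

text \<open>Left multiplications have square zero. A nonzero product
  \<open>e = a \<otimes> b\<close> is annihilated by every left factor and itself acts as zero; with
  \<open>b\<close> it forms a basis satisfying \<open>b \<otimes> b = e\<close>, which matches
  \<open>(1, 0)\<close> and \<open>(0, 1)\<close> in the nontrivial model.\<close>

lemma isomorphic_elementary_order_4:
  assumes card: "order A = 4" and two: "\<And>x. x \<in> carrier A \<Longrightarrow> x \<oplus> x = \<zero>"
  shows "brace_isomorphic A trivial_brace_22 \<or> brace_isomorphic A nontrivial_brace_22"
proof -
  have cancel: "x \<oplus> (x \<oplus> y) = y" "x \<oplus> (y \<oplus> x) = y" "(x \<oplus> y) \<oplus> x = y" "(y \<oplus> x) \<oplus> x = y"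
    if "x \<in> carrier A" "y \<in> carrier A" for x y
  proof -
    show *: "x \<oplus> (x \<oplus> y) = y" using that by (simp add: a_assoc[symmetric] two)
    show "x \<oplus> (y \<oplus> x) = y" "(x \<oplus> y) \<oplus> x = y" "(y \<oplus> x) \<oplus> x = y"
      using * that by (simp_all add: a_comm)
  qed
  have table: "carrier A = {\<zero>, x, y, x \<oplus> y}"
      "x \<oplus> y \<noteq> \<zero>" "x \<oplus> y \<noteq> x" "x \<oplus> y \<noteq> y"
    if xy: "x \<in> carrier A" "y \<in> carrier A" "x \<noteq> \<zero>" "y \<noteq> \<zero>" "x \<noteq> y" for x y
  proof -
    show ne: "x \<oplus> y \<noteq> \<zero>" "x \<oplus> y \<noteq> x" "x \<oplus> y \<noteq> y"
      using cancel(1,3)[of x y] cancel(1)[of y x] xy two[of x] two[of y]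
      by (metis r_zero l_zero)+
    show "carrier A = {\<zero>, x, y, x \<oplus> y}"
      by (rule card_subset_eq[OF finite_carrier, symmetric])
        (use xy card ne ne[symmetric] in \<open>auto simp: order_def\<close>)
  qed
  \<comment> \<open>The isomorphism is prescribed on a basis. Premise \<open>mult\<close> speaks
    about any \<open>f\<close> with the four values, because the map is constructed only inside this
    proof.\<close>
  have iso: "brace_isomorphic A B"
    if xy: "x \<in> carrier A" "y \<in> carrier A" "x \<noteq> \<zero>" "y \<noteq> \<zero>" "x \<noteq> y"
      and B: "carrier B = {(0, 0), (0, 1), (1, 0), (1, 1)}"
        "\<And>a b c d :: int. (a, b) \<oplus>\<^bsub>B\<^esub> (c, d) = ((a + c) mod 2, (b + d) mod 2)"
      and mult: "\<And>f :: 'a \<Rightarrow> int \<times> int. f \<zero> = (0, 0) \<Longrightarrow> f x = (1, 0) \<Longrightarrow> f y = (0, 1) \<Longrightarrow>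
        f (x \<oplus> y) = (1, 1) \<Longrightarrow> \<forall>u \<in> {\<zero>, x, y, x \<oplus> y}. \<forall>v \<in> {\<zero>, x, y, x \<oplus> y}. f (u \<otimes> v) = f u \<otimes>\<^bsub>B\<^esub> f v"
    for x y and B :: "(int \<times> int) ring"
  proof -
    note t = table[OF xy]
    define f :: "'a \<Rightarrow> int \<times> int" where
      "f u = (if u = \<zero> then (0, 0) else if u = x then (1, 0) else if u = y then (0, 1) else (1, 1))" for u
    have f: "f \<zero> = (0, 0)" "f x = (1, 0)" "f y = (0, 1)" "f (x \<oplus> y) = (1, 1)"
      using t(2-4) xy(3-5) by (auto simp: f_def)
    have "bij_betw f (carrier A) (carrier B)"
      unfolding t(1) bij_betw_def B(1) by (auto simp: inj_on_def f)
    moreover have "\<forall>u \<in> carrier A. \<forall>v \<in> carrier A. f (u \<oplus> v) = f u \<oplus>\<^bsub>B\<^esub> f v"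
      unfolding t(1) using xy(1,2)
      by (simp add: f B(2) two cancel a_comm[of y x])
    moreover have "\<forall>u \<in> carrier A. \<forall>v \<in> carrier A. f (u \<otimes> v) = f u \<otimes>\<^bsub>B\<^esub> f v"
      unfolding t(1) by (rule mult[OF f])
    ultimately show ?thesis
      unfolding brace_isomorphic_def by blast
  qed
  \<comment> \<open>In characteristic 2, \<open>lam a ^ 4 = 1\<close> says that multiplication by \<open>a\<close> is nilpotent.\<close>
  have nil: "a \<otimes> (a \<otimes> v) = \<zero>" if a: "a \<in> carrier A" and v: "v \<in> carrier A" for a v
  proof -
    have nil4: "a \<otimes> (a \<otimes> (a \<otimes> (a \<otimes> u))) = \<zero>" if u: "u \<in> carrier A" for u
    proof -
      have 2: "lam a (lam a u) = a \<otimes> (a \<otimes> u) \<oplus> u" if "u \<in> carrier A" for u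
      proof -
        have "lam a (lam a u) = a \<otimes> (a \<otimes> u) \<oplus> (a \<otimes> u \<oplus> (a \<otimes> u \<oplus> u))"
          using a that by (simp add: lam_def left_distrib a_assoc)
        then show ?thesis using cancel(1)[of "a \<otimes> u" u] a that by simp
      qed
      have "(lam a ^^ card (carrier A)) u = u"
        using lam_funpow_card[OF add.subgroup_self] a u by simp
      then have "lam a (lam a (lam a (lam a u))) = u"
        using card by (simp add: order_def numeral_eq_Suc)
      then have "u = a \<otimes> (a \<otimes> (a \<otimes> (a \<otimes> u))) \<oplus> (a \<otimes> (a \<otimes> u) \<oplus> (a \<otimes> (a \<otimes> u) \<oplus> u))"
        using a u by (simp add: 2 left_distrib a_assoc)
      also have "\<dots> = a \<otimes> (a \<otimes> (a \<otimes> (a \<otimes> u))) \<oplus> u"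
        using cancel(1)[of "a \<otimes> (a \<otimes> u)" u] a u by simp
      finally have *: "u = a \<otimes> (a \<otimes> (a \<otimes> (a \<otimes> u))) \<oplus> u" .
      have "a \<otimes> (a \<otimes> (a \<otimes> (a \<otimes> u))) \<in> carrier A" using a u by simp
      from add.r_cancel_one'[OF u this] * show ?thesis by blast
    qed
    show ?thesis
    proof (cases "v = \<zero>")
      case False
      \<comment> \<open>\<open>k\<close> is the last nonzero term among \<open>v\<close>,
        \<open>a \<otimes> v\<close>, \<open>a \<otimes> (a \<otimes> v)\<close> and so on;
        \<open>nil4\<close> stops the sequence.\<close>
      obtain k where k: "k \<in> carrier A" "k \<noteq> \<zero>" "a \<otimes> k = \<zero>"
        using nil4[OF v] False a v by (metis mult_closed)
      \<comment> \<open>Otherwise \<open>k\<close> and \<open>i\<close> form a basis, and a preimage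
        of \<open>i\<close> equals \<open>i\<close> up to the kernel element \<open>k\<close>. Then
        \<open>a \<otimes> i = i\<close>, against nilpotency.\<close>
      have mult0: "a \<otimes> i = \<zero>" if i: "i \<in> carrier A" "\<exists>u\<in>carrier A. i = a \<otimes> u" for i
      proof (rule ccontr)
        assume ni: "a \<otimes> i \<noteq> \<zero>"
        then have "i \<noteq> \<zero>" "i \<noteq> k" using k a by auto
        then have t: "carrier A = {\<zero>, k, i, k \<oplus> i}"
          by (intro table(1) k(1,2) i(1)) auto
        from i(2) obtain u where u: "u \<in> carrier A" "a \<otimes> u = i" by auto
        have "u \<noteq> \<zero>" "u \<noteq> k" using u(2) k(3) a \<open>i \<noteq> \<zero>\<close> by auto
        with u(1) t have "u = i \<or> u = k \<oplus> i" by simp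
        then have "a \<otimes> i = i" using u(2) a k i(1) left_distrib[of a k i] by auto
        then show False using nil4[OF i(1)] \<open>i \<noteq> \<zero>\<close> by simp
      qed
      show ?thesis by (rule mult0) (use a v in auto)
    qed (use a in simp)
  qed
  show ?thesis
  proof (cases "\<forall>a \<in> carrier A. \<forall>b \<in> carrier A. a \<otimes> b = \<zero>")
    case True
    have "\<not> carrier A \<subseteq> {\<zero>}"
      using card card_mono[of "{\<zero>}" "carrier A"] by (auto simp: order_def)
    then obtain x where x: "x \<in> carrier A" "x \<noteq> \<zero>" by blast
    have "\<not> carrier A \<subseteq> {\<zero>, x}"
      using card card_mono[of "{\<zero>, x}" "carrier A"] x by (auto simp: order_def)
    then obtain y where y: "y \<in> carrier A" "y \<noteq> \<zero>" "x \<noteq> y" by blast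
    have "brace_isomorphic A trivial_brace_22"
      by (rule iso[of x y]) (use x y True in auto)
    then show ?thesis ..
  next
    case False
    then obtain a b where ab: "a \<in> carrier A" "b \<in> carrier A" "a \<otimes> b \<noteq> \<zero>" by blast
    define e where "e = a \<otimes> b"
    have e: "e \<in> carrier A" "e \<noteq> \<zero>" using ab by (simp_all add: e_def)
    have ae: "a \<otimes> e = \<zero>" unfolding e_def by (rule nil[OF ab(1,2)])
    have eb: "e \<noteq> b" using ae e e_def by auto
    have b0: "b \<noteq> \<zero>" using ab by auto
    note t = table[OF e(1) ab(2) e(2) b0 eb]
    \<comment> \<open>Otherwise, multiplication by the circle product of \<open>a\<close> and \<open>c\<close> would not be nilpotent.\<close>
    have mult_e: "c \<otimes> e = \<zero>" if c: "c \<in> carrier A" for c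
    proof (rule ccontr)
      assume nz: "c \<otimes> e \<noteq> \<zero>"
      define v where "v = c \<otimes> e"
      have v: "v \<in> carrier A" "v \<noteq> \<zero>" using nz c e by (simp_all add: v_def)
      have cv: "c \<otimes> v = \<zero>" unfolding v_def by (rule nil[OF c e(1)])
      have "v \<noteq> e" using nz cv by auto
      moreover have "v \<in> {\<zero>, e, b, e \<oplus> b}"
        using v(1) unfolding t(1) .
      ultimately have "v = b \<or> v = e \<oplus> b" using v(2) by simp
      then have av: "a \<otimes> v = e" using ab e by (auto simp: left_distrib ae e_def[symmetric])
      define d where "d = a \<otimes> c \<oplus> a \<oplus> c"
      have d: "d \<in> carrier A" using ab c by (simp add: d_def)
      have dd: "d \<otimes> u = a \<otimes> (c \<otimes> u) \<oplus> a \<otimes> u \<oplus> c \<otimes> u" if "u \<in> carrier A" for u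
        unfolding d_def by (rule circle_action[OF ab(1) c that])
      have de: "d \<otimes> e = e \<oplus> v" using dd[OF e(1)] e v by (simp add: v_def[symmetric] av ae)
      have dv: "d \<otimes> v = e" using dd[OF v(1)] e v ab by (simp add: av cv)
      have "d \<otimes> (d \<otimes> e) = v" using d e v by (simp add: de dv left_distrib cancel)
      then show False using nil[OF d e(1)] v by simp
    qed
    have mult_b: "c \<otimes> b = \<zero> \<or> c \<otimes> b = e" if c: "c \<in> carrier A" for c
    proof (rule ccontr)
      assume *: "\<not> ?thesis"
      moreover have "c \<otimes> b \<in> {\<zero>, e, b, e \<oplus> b}"
        using mult_closed[OF c ab(2)] unfolding t(1) .
      ultimately have "c \<otimes> b = b \<or> c \<otimes> b = e \<oplus> b" by simp
      then have "c \<otimes> (c \<otimes> b) \<noteq> \<zero>"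
        using * c e ab by (auto simp: left_distrib mult_e)
      with nil[OF c ab(2)] show False by simp
    qed
    have eb0: "e \<otimes> b = \<zero>"
    proof (rule ccontr)
      assume "e \<otimes> b \<noteq> \<zero>"
      then have "e \<otimes> b = e" using mult_b e by blast
      then have "e \<otimes>\<^bsub>circle_group A\<^esub> b = b"
        using e ab by (simp add: circle_group_def two)
      then have "e = \<one>\<^bsub>circle_group A\<^esub>"
        using group.r_cancel_one[OF group_circle, of b e] e ab by (simp add: circle_group_def)
      with e show False by (simp add: circle_group_def)
    qed
    \<comment> \<open>Because \<open>e \<otimes> b = \<zero>\<close>, the sum
      \<open>e \<oplus> b\<close> is the circle product of \<open>e\<close> and \<open>b\<close>.
      Since \<open>e\<close> acts trivially, the two candidates for \<open>a\<close>, namely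
      \<open>b\<close> and \<open>e \<oplus> b\<close>, multiply \<open>b\<close> alike.\<close>
    have "(e \<oplus> b) \<otimes> b = (e \<otimes> b \<oplus> e \<oplus> b) \<otimes> b"
      using e ab by (simp add: eb0)
    also have "\<dots> = e \<otimes> (b \<otimes> b) \<oplus> e \<otimes> b \<oplus> b \<otimes> b"
      by (rule circle_action) (use e ab in auto)
    also have "\<dots> = b \<otimes> b"
      using mult_b[OF ab(2)] mult_e[OF e(1)] e by (auto simp: eb0)
    finally have ebb: "(e \<oplus> b) \<otimes> b = b \<otimes> b" .
    have "a \<noteq> \<zero>" "a \<noteq> e" using ab eb0 by auto
    moreover have "a \<in> {\<zero>, e, b, e \<oplus> b}"
      using ab(1) unfolding t(1) .
    ultimately have "a = b \<or> a = e \<oplus> b" by simp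
    then have bb: "b \<otimes> b = e" using ebb by (auto simp: e_def)
    have "brace_isomorphic A nontrivial_brace_22"
      by (rule iso[of e b])
        (use e ab b0 eb bb ebb eb0 in \<open>auto simp: left_distrib mult_e cancel two\<close>)
    then show ?thesis ..
  qed
qed

end

section \<open>Fourth roots of unity modulo a prime\<close>

lemma cong_power_mod_4:
  fixes w :: int
  assumes w: "[w ^ 4 = 1] (mod m)" and ij: "i mod 4 = j mod 4"
  shows "[w ^ i = w ^ j] (mod m)"
proof -
  have "[w ^ n = w ^ (n mod 4)] (mod m)" for n
  proof -
    have "w ^ n = (w ^ 4) ^ (n div 4) * w ^ (n mod 4)"
      by (simp flip: power_mult power_add)
    also have "[\<dots> = 1 ^ (n div 4) * w ^ (n mod 4)] (mod m)"
      by (intro cong_mult cong_pow w cong_refl)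
    finally show ?thesis by simp
  qed
  from this[of i] this[of j] show ?thesis
    unfolding ij by (metis cong_sym cong_trans)
qed

lemma cong_square_eq_1:
  fixes t :: int
  assumes q: "prime q" and t: "[t * t = 1] (mod int q)"
  shows "[t = 1] (mod int q) \<or> [t = - 1] (mod int q)"
proof -
  have "int q dvd (t - 1) * (t + 1)"
    using t by (simp add: cong_iff_dvd_diff algebra_simps)
  then show ?thesis
    using q by (simp add: cong_iff_dvd_diff prime_dvd_mult_iff)
qed

text \<open>The square of \<open>t\<close> is a sign. If it is \<open>- 1\<close>, then
  \<open>4 dvd q - 1\<close> has to be derived before anything is known about \<open>w\<close>:
  otherwise \<open>q - 1 = 4 * k + 2\<close>, and Fermat's theorem gives
  \<open>1 = t ^ 2 = - 1\<close> modulo \<open>q\<close>. The root \<open>- w\<close> is written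
  \<open>w ^ 3\<close> so that exponents can later be compared modulo 4.\<close>

lemma fourth_roots_mod_prime:
  fixes t :: int
  assumes q: "prime q" "q > 3" and t: "[t ^ 4 = 1] (mod int q)"
    and w: "4 dvd q - 1 \<Longrightarrow> [w ^ 2 = - 1] (mod int q)"
  shows "[t = 1] (mod int q) \<or> [t = - 1] (mod int q) \<or>
    (4 dvd q - 1 \<and> ([t = w] (mod int q) \<or> [t = w ^ 3] (mod int q)))"
proof -
  have "[t ^ 2 * t ^ 2 = 1] (mod int q)"
    using t by (simp flip: power_add)
  then consider "[t ^ 2 = 1] (mod int q)" | "[t ^ 2 = - 1] (mod int q)"
    using cong_square_eq_1[OF q(1)] by blast
  then show ?thesis
  proof cases
    case 1
    then show ?thesis using cong_square_eq_1[OF q(1), of t] unfolding power2_eq_square by blast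
  next
    case 2
    have q1: "4 dvd q - 1"
    proof (rule ccontr)
      assume *: "\<not> 4 dvd q - 1"
      have "odd q" using q prime_odd_nat[of q] by simp
      then have e: "even (q - 1)" using q by simp
      define k where "k = (q - 1) div 4"
      have k: "q - 1 = 4 * k + 2"
        using * e unfolding k_def by presburger
      have "\<not> int q dvd t"
      proof
        assume "int q dvd t"
        then have "int q dvd t ^ 4" by (simp add: numeral_eq_Suc)
        then have "int q dvd 1"
          using t by (simp add: cong_dvd_iff[of "t ^ 4" 1])
        then show False using q by simp
      qed
      then have "coprime t (int q)"
        using q(1) by (metis coprime_commute prime_imp_coprime prime_int_nat_transfer prime_nat_int_transfer)
      then have "[t ^ (q - 1) = 1] (mod int q)"
        using residues.euler_theorem[of "int q" t] q by (simp add: residues_def totient_prime)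
      moreover have "[t ^ (q - 1) = t ^ 2] (mod int q)"
        by (rule cong_power_mod_4[OF t]) (unfold k, presburger)
      ultimately have "[1 = - 1] (mod int q)"
        using 2 by (metis cong_sym cong_trans)
      then have "int q dvd 2" by (simp add: cong_iff_dvd_diff)
      then show False using q by (auto dest: zdvd_imp_le)
    qed
    have "[t ^ 2 - w ^ 2 = (-1) - (-1)] (mod int q)"
      by (intro cong_diff 2 w q1)
    then have "int q dvd (t - w) * (t + w)"
      by (simp add: cong_iff_dvd_diff algebra_simps power2_eq_square)
    then have "[t = w] (mod int q) \<or> [t = - w] (mod int q)"
      using q by (simp add: cong_iff_dvd_diff prime_dvd_mult_iff)
    moreover have "[(-1) * w = w ^ 2 * w] (mod int q)"
      by (intro cong_mult cong_sym[OF w] q1 cong_refl)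
    then have "[- w = w ^ 3] (mod int q)"
      by (simp add: power3_eq_cube power2_eq_square)
    ultimately show ?thesis using q1 cong_trans by blast
  qed
qed

text \<open>This turns the order of \<open>w\<close> in the unit group into a congruence between
  integers, the only property of \<open>w\<close> that enters afterwards.\<close>

lemma primitive_fourth_root_square:
  assumes q: "prime q" "q > 3" and w: "primitive_fourth_root_mod q w"
  shows "[w ^ 2 = - 1] (mod int q)"
proof -
  let ?R = "residue_ring (int q)"
  interpret residues "int q" ?R by unfold_locales (use q in auto)
  interpret U: group "units_of ?R" by (rule units_group)
  have wU: "w \<in> carrier (units_of ?R)" and ord: "U.ord w = 4"
    using w by (simp_all add: primitive_fourth_root_mod_def units_of_carrier)
  have wc: "w \<in> Units ?R" using wU by (simp add: units_of_carrier)
  have wmod: "w mod int q = w"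
    using Units_closed[OF wc] by (simp add: res_carrier_eq)
  have pow: "w [^]\<^bsub>units_of ?R\<^esub> n = \<one>\<^bsub>units_of ?R\<^esub> \<longleftrightarrow> [w ^ n = 1] (mod int q)" for n :: nat
    using units_of_pow[OF wc, of n] pow_cong[of w n] wmod q
    by (simp add: cong_def units_of_one res_one_eq)
  have "[w ^ 4 = 1] (mod int q)" "\<not> [w ^ 2 = 1] (mod int q)"
    using U.pow_eq_id[OF wU] ord by (simp_all flip: pow)
  moreover from this(1) have "[w ^ 2 * w ^ 2 = 1] (mod int q)"
    by (simp flip: power_add)
  ultimately show ?thesis using cong_square_eq_1[OF q(1)] by blast
qed

section \<open>The listed braces\<close>

text \<open>The digit formulas come from the circle groups. In \<open>nontrivial_brace_22\<close>
  the circle square of \<open>(0, 1)\<close> is \<open>(1, 0)\<close>, so the group is cyclic and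
  \<open>2 * x + y\<close> is the exponent of \<open>(x, y)\<close>. In
  \<open>nontrivial_brace_4\<close> the elements 1 and 2 are circle involutions with circle product
  3, so the binary digits are coordinates.\<close>

lemma brace_characters:
  fixes w m :: int
  shows "\<lbrakk>w \<in> {1, - 1}; m \<in> {1, - 1}\<rbrakk> \<Longrightarrow>
      brace_character trivial_brace_22 (\<lambda>(x, y). w ^ nat x * m ^ nat y) q"
    and "\<lbrakk>w \<in> {1, - 1}; m \<in> {1, - 1}\<rbrakk> \<Longrightarrow>
      brace_character nontrivial_brace_4 (\<lambda>u. w ^ nat (u div 2) * m ^ nat (u mod 2)) q"
    and "[w ^ 4 = 1] (mod int q) \<Longrightarrow> brace_character trivial_brace_4 (\<lambda>x. w ^ nat x) q"
    and "[w ^ 4 = 1] (mod int q) \<Longrightarrow>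
      brace_character nontrivial_brace_22 (\<lambda>(x, y). w ^ nat (2 * x + y)) q"
proof -
  show "brace_character trivial_brace_22 (\<lambda>(x, y). w ^ nat x * m ^ nat y) q"
    if "w \<in> {1, - 1}" "m \<in> {1, - 1}"
  proof -
    from that have "(w = 1 \<and> m = 1) \<or> (w = 1 \<and> m = - 1) \<or> (w = - 1 \<and> m = 1) \<or> (w = - 1 \<and> m = - 1)"
      by auto
    then show ?thesis
      by (elim disjE conjE) (simp_all add: brace_character_def)
  qed
  show "brace_character nontrivial_brace_4 (\<lambda>u. w ^ nat (u div 2) * m ^ nat (u mod 2)) q"
    if "w \<in> {1, - 1}" "m \<in> {1, - 1}"
  proof -
    from that have "(w = 1 \<and> m = 1) \<or> (w = 1 \<and> m = - 1) \<or> (w = - 1 \<and> m = 1) \<or> (w = - 1 \<and> m = - 1)"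
      by auto
    then show ?thesis
      unfolding brace_character_def brace_4_simps ball_simps
      by (elim disjE conjE; hypsubst; intro conjI; simp)
  qed
  assume w: "[w ^ 4 = 1] (mod int q)"
  have pow: "[w ^ k = w ^ i * w ^ j] (mod int q)" if "k mod 4 = (i + j) mod 4" for i j k
    unfolding power_add[symmetric] by (rule cong_power_mod_4[OF w that])
  show "brace_character trivial_brace_4 (\<lambda>x. w ^ nat x) q"
    unfolding brace_character_def
  proof (intro conjI ballI)
    fix x y assume "x \<in> carrier trivial_brace_4" "y \<in> carrier trivial_brace_4"
    then show "[w ^ nat (x \<otimes>\<^bsub>trivial_brace_4\<^esub> y \<oplus>\<^bsub>trivial_brace_4\<^esub> x \<oplus>\<^bsub>trivial_brace_4\<^esub> y)
       = w ^ nat x * w ^ nat y] (mod int q)"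
      by (intro pow) auto
  qed simp
  show "brace_character nontrivial_brace_22 (\<lambda>(x, y). w ^ nat (2 * x + y)) q"
    unfolding brace_character_def
  proof (intro conjI ballI)
    fix u v assume "u \<in> carrier nontrivial_brace_22" "v \<in> carrier nontrivial_brace_22"
    then show "[(\<lambda>(x, y). w ^ nat (2 * x + y))
        (u \<otimes>\<^bsub>nontrivial_brace_22\<^esub> v \<oplus>\<^bsub>nontrivial_brace_22\<^esub> u \<oplus>\<^bsub>nontrivial_brace_22\<^esub> v)
       = (\<lambda>(x, y). w ^ nat (2 * x + y)) u * (\<lambda>(x, y). w ^ nat (2 * x + y)) v] (mod int q)"
      by (cases u; cases v; simp only: prod.case brace_22_simps; intro pow) auto
  qed simp
qed

lemma order_extension:
  "order (brace_extension P chi q) = order P * q"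
  by (simp add: order_def card_cartesian_product)

text \<open>Deliberately coarser than the list: all pairs of signs give braces, so each family can
  be handled uniformly.\<close>

lemma brace_list_cases:
  assumes "l \<in> brace_list q w"
  obtains w' m where "l = T22 w' m" "w' \<in> {1, - 1}" "m \<in> {1, - 1}"
  | w' m where "l = B4 w' m" "w' \<in> {1, - 1}" "m \<in> {1, - 1}"
  | w' where "l = T4 w'" "w' \<in> {1, - 1} \<or> (4 dvd q - 1 \<and> w' = w)"
  | w' where "l = B22 w'" "w' \<in> {1, - 1} \<or> (4 dvd q - 1 \<and> w' = w)"
  using assms by (cases l) (auto simp: brace_list_def split: if_splits)

lemma brace_list_brace_of_order:
  assumes q: "q > 1" and w: "4 dvd q - 1 \<Longrightarrow> [w ^ 4 = 1] (mod int q)"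
    and l: "l \<in> brace_list q w"
  shows "labels_brace_of_order (4 * q) q l"
  using l
proof (cases rule: brace_list_cases)
  case (1 w' m)
  then show ?thesis
    using left_brace_extension[OF left_brace_order_4(1) brace_characters(1) q]
    by (auto simp: named_brace_eq_extension order_extension) (simp_all add: order_def)
next
  case (2 w' m)
  then show ?thesis
    using left_brace_extension[OF left_brace_order_4(4) brace_characters(2) q]
    by (auto simp: named_brace_eq_extension order_extension) (simp_all add: order_def)
next
  case (3 w')
  then have "[w' ^ 4 = 1] (mod int q)" using w by auto
  then show ?thesis
    using 3 left_brace_extension[OF left_brace_order_4(2) brace_characters(3) q]
    by (auto simp: named_brace_eq_extension order_extension) (simp_all add: order_def)
next
  case (4 w')
  then have "[w' ^ 4 = 1] (mod int q)" using w by auto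
  then show ?thesis
    using 4 left_brace_extension[OF left_brace_order_4(3) brace_characters(4) q]
    by (auto simp: named_brace_eq_extension order_extension) (simp_all add: order_def)
qed

section \<open>Separation of the listed braces\<close>

fun label_signature :: "nat \<Rightarrow> brace_label \<Rightarrow> bool \<times> bool \<times> bool \<times> bool \<times> bool"
  where
    "label_signature q (T22 w m) = brace_signature (brace_T22 q w m)"
  | "label_signature q (T4 w) = brace_signature (brace_T4 q w)"
  | "label_signature q (B22 w) = brace_signature (brace_B22 q w)"
  | "label_signature q (B4 w m) = brace_signature (brace_B4 q w m)"

lemma label_signature_eq:
  assumes "left_brace A" "labels_brace_of_order n q l" "isomorphic_to_label q A l"
  shows "brace_signature A = label_signature q l"
  using assms by (cases l) (auto intro!: brace_signature_isomorphic)

lemma brace_signature_extension_order_4: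
  assumes "left_brace P" "order P = 4" "odd q" "q > 1"
  shows "brace_signature (brace_extension P chi q) =
   (\<forall>x \<in> carrier P. x \<oplus>\<^bsub>P\<^esub> x = \<zero>\<^bsub>P\<^esub>,
    \<forall>x \<in> carrier P. \<forall>y \<in> carrier P. x \<otimes>\<^bsub>P\<^esub> y = \<zero>\<^bsub>P\<^esub>,
    \<forall>x \<in> carrier P. [chi x = 1] (mod int q),
    \<forall>x \<in> carrier P. [chi (x \<oplus>\<^bsub>P\<^esub> x) = 1] (mod int q),
    \<forall>x \<in> carrier P. \<forall>y \<in> carrier P. [chi (x \<otimes>\<^bsub>P\<^esub> y) = 1] (mod int q))"
  by (rule brace_signature_extension[OF assms(1) left_brace.quadruple_order_4[OF assms(1,2)] assms(3,4)])

text \<open>The first two components separate the four families. Inside a family it suffices that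
  neither \<open>- 1\<close> nor \<open>w ^ 2\<close> is 1 modulo \<open>q\<close>. For
  \<open>B4\<close> the doubles are 0 and 2, so the fourth component sees the sign at 2
  independently of the sign at 1.\<close>

lemma inj_on_label_signature:
  assumes q: "odd q" "q > 2" and w: "4 dvd q - 1 \<Longrightarrow> [w ^ 2 = - 1] (mod int q)"
  shows "inj_on (label_signature q) (brace_list q w)"
proof -
  have q1: "Suc 0 < q" using q by simp
  note sig4 = brace_signature_extension_order_4[OF left_brace_order_4(1)]
    brace_signature_extension_order_4[OF left_brace_order_4(2)]
    brace_signature_extension_order_4[OF left_brace_order_4(3)]
    brace_signature_extension_order_4[OF left_brace_order_4(4)]
  have sig: "label_signature q (T22 w' m) = (True, True, [w' = 1] (mod int q) \<and> [m = 1] (mod int q) \<and>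
        [w' * m = 1] (mod int q), True, True)"
    "label_signature q (T4 w') = (False, True,
       [w' = 1] (mod int q) \<and> [w' ^ 2 = 1] (mod int q) \<and> [w' ^ 3 = 1] (mod int q),
       [w' ^ 2 = 1] (mod int q), True)"
    "label_signature q (B22 w') = (True, False,
       [w' = 1] (mod int q) \<and> [w' ^ 2 = 1] (mod int q) \<and> [w' ^ 3 = 1] (mod int q),
       True, [w' ^ 2 = 1] (mod int q))"
    "label_signature q (B4 w' m) = (False, False,
       [w' = 1] (mod int q) \<and> [m = 1] (mod int q) \<and> [w' * m = 1] (mod int q),
       [w' = 1] (mod int q), [w' = 1] (mod int q))" for w' m
    using q(1) q1 by (auto simp: named_brace_eq_extension sig4 order_def)
  have ne: "\<not> [- 1 = 1] (mod int q)"
    using q by (auto simp: cong_iff_dvd_diff dest: zdvd_imp_le)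
  have nw: "\<not> [w ^ 2 = 1] (mod int q)" "\<not> [w = 1] (mod int q)" if "4 dvd q - 1"
  proof -
    show 1: "\<not> [w ^ 2 = 1] (mod int q)"
      using w[OF that] ne by (metis cong_sym cong_trans)
    show "\<not> [w = 1] (mod int q)"
      using 1 cong_pow[of w 1 "int q" 2] by auto
  qed
  show ?thesis
  proof (cases "4 dvd q - 1")
    case True
    then show ?thesis
      using ne nw by (auto simp: inj_on_def brace_list_def sig simp del: label_signature.simps)
  next
    case False
    then show ?thesis
      using ne by (auto simp: inj_on_def brace_list_def sig simp del: label_signature.simps)
  qed
qed

section \<open>Classification\<close>

text \<open>Pulling \<open>chi\<close> back along an isomorphism replaces an unknown brace of order
  4 by its model.\<close>

lemma character_transport:
  assumes P: "left_brace P" and K: "left_brace K" and iso: "brace_isomorphic P K"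
    and chi: "brace_character P chi q"
  obtains chi' where "brace_character K chi' q"
    "brace_isomorphic (brace_extension K chi' q) (brace_extension P chi q)"
proof -
  interpret P: left_brace P by fact
  interpret K: left_brace K by fact
  obtain g where g: "bij_betw g (carrier K) (carrier P)"
    "\<And>x y. \<lbrakk>x \<in> carrier K; y \<in> carrier K\<rbrakk> \<Longrightarrow> g (x \<oplus>\<^bsub>K\<^esub> y) = g x \<oplus>\<^bsub>P\<^esub> g y"
    "\<And>x y. \<lbrakk>x \<in> carrier K; y \<in> carrier K\<rbrakk> \<Longrightarrow> g (x \<otimes>\<^bsub>K\<^esub> y) = g x \<otimes>\<^bsub>P\<^esub> g y"
    using brace_isomorphic_sym[OF P iso] unfolding brace_isomorphic_def by blast
  have gc: "g x \<in> carrier P" if "x \<in> carrier K" for x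
    using g(1) that by (auto simp: bij_betw_def)
  have g0: "g \<zero>\<^bsub>K\<^esub> = \<zero>\<^bsub>P\<^esub>"
    using g(2)[of "\<zero>\<^bsub>K\<^esub>" "\<zero>\<^bsub>K\<^esub>"] gc[of "\<zero>\<^bsub>K\<^esub>"]
    by (metis K.r_zero K.zero_closed P.add.r_cancel_one')
  have "brace_character K (chi \<circ> g) q"
    using chi by (simp add: brace_character_def g g0 gc)
  moreover have "brace_isomorphic (brace_extension K (chi \<circ> g) q) (brace_extension P chi q)"
    by (rule brace_extension_isomorphic[OF g]) auto
  ultimately show thesis by (rule that)
qed

text \<open>The circle product is named by an equation so that \<open>z\<close> can be a numeral and
  the equation is discharged by evaluation in a model.\<close>

lemma character_closed:
  assumes "brace_character P chi q" "x \<in> carrier P" "y \<in> carrier P"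
    "x \<otimes>\<^bsub>P\<^esub> y \<oplus>\<^bsub>P\<^esub> x \<oplus>\<^bsub>P\<^esub> y = z"
  shows "[chi z = chi x * chi y] (mod int q)"
  using assms by (auto simp: brace_character_def)

lemma character_zero:
  "\<lbrakk>brace_character P chi q; \<zero>\<^bsub>P\<^esub> = z\<rbrakk> \<Longrightarrow> [chi z = 1] (mod int q)"
  by (simp add: brace_character_def)

section \<open>Characters of the models up to brace automorphism\<close>

lemma cong_power_Suc:
  fixes t :: int
  assumes "[c = t * b] (mod m)" "[b = t ^ n] (mod m)"
  shows "[c = t ^ Suc n] (mod m)"
  using cong_trans[OF assms(1) cong_mult[OF cong_refl assms(2)]] by simp

text \<open>The value \<open>t\<close> at the generator 1 determines the character, and returning to
  0 after four steps forces \<open>t ^ 4 = 1\<close>. Negation is an automorphism that inverts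
  \<open>t\<close>, so \<open>w ^ 3\<close> and \<open>w\<close> give isomorphic extensions.\<close>

lemma extension_trivial_brace_4_label:
  assumes q: "prime q" "q > 3" and w: "4 dvd q - 1 \<Longrightarrow> [w ^ 2 = - 1] (mod int q)"
    and chi: "brace_character trivial_brace_4 chi q"
  shows "\<exists>l \<in> brace_list q w. isomorphic_to_label q (brace_extension trivial_brace_4 chi q) l"
proof -
  define t where "t = chi 1"
  note mult = character_closed[OF chi]
  have 0: "[chi 0 = t ^ 0] (mod int q)" using character_zero[OF chi] by simp
  have 1: "[chi 1 = t ^ 1] (mod int q)" by (simp add: t_def)
  have 2: "[chi 2 = t ^ 2] (mod int q)"
    using cong_power_Suc[OF mult[of 1 1 2, folded t_def] 1[folded t_def]] by (simp add: numeral_eq_Suc)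
  have 3: "[chi 3 = t ^ 3] (mod int q)"
    using cong_power_Suc[OF mult[of 1 2 3, folded t_def] 2] by (simp add: numeral_eq_Suc)
  have "[chi 0 = t ^ 4] (mod int q)"
    using cong_power_Suc[OF mult[of 1 3 0, folded t_def] 3] by (simp add: numeral_eq_Suc)
  then have t4: "[t ^ 4 = 1] (mod int q)"
    using cong_trans[OF cong_sym 0] by simp
  have chi_pow: "[chi x = t ^ nat x] (mod int q)" if "x \<in> {0, 1, 2, 3}" for x
    using that 0 1 2 3 by auto
  have id: "brace_isomorphic (brace_extension trivial_brace_4 chi q) (brace_T4 q v)"
    if "[t = v] (mod int q)" for v
    unfolding named_brace_eq_extension
  proof (rule brace_extension_isomorphic[where f = id])
    fix x assume "x \<in> carrier trivial_brace_4"
    then have "[chi x = t ^ nat x] (mod int q)" by (intro chi_pow) simp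
    also have "[t ^ nat x = v ^ nat x] (mod int q)" by (rule cong_pow[OF that])
    finally show "[v ^ nat (id x) = chi x] (mod int q)" by (simp add: cong_sym)
  qed (auto simp: bij_betw_def)
  have neg: "brace_isomorphic (brace_extension trivial_brace_4 chi q) (brace_T4 q w)"
    if "4 dvd q - 1" "[t = w ^ 3] (mod int q)"
    unfolding named_brace_eq_extension
  proof (rule brace_extension_isomorphic[where f = "\<lambda>x. (- x) mod 4"])
    have w4: "[w ^ 4 = 1] (mod int q)"
      using cong_pow[OF w[OF that(1)], of 2] by simp
    fix x assume x: "x \<in> carrier trivial_brace_4"
    then have "[chi x = t ^ nat x] (mod int q)" by (intro chi_pow) simp
    also have "[t ^ nat x = w ^ (3 * nat x)] (mod int q)"
      unfolding power_mult by (rule cong_pow[OF that(2)])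
    also have "[w ^ (3 * nat x) = w ^ nat (- x mod 4)] (mod int q)"
      by (rule cong_power_mod_4[OF w4]) (use x in auto)
    finally show "[w ^ nat (- x mod 4) = chi x] (mod int q)" by (rule cong_sym)
  qed (auto simp: bij_betw_def inj_on_def)
  from fourth_roots_mod_prime[OF q t4 w]
  consider "[t = 1] (mod int q)" | "[t = - 1] (mod int q)"
    | "4 dvd q - 1" "[t = w] (mod int q)" | "4 dvd q - 1" "[t = w ^ 3] (mod int q)"
    by blast
  then show ?thesis
  proof cases
    case 1
    from id[OF this] show ?thesis by (intro bexI[of _ "T4 1"]) (auto simp: brace_list_def)
  next
    case 2
    from id[OF this] show ?thesis by (intro bexI[of _ "T4 (- 1)"]) (auto simp: brace_list_def)
  next
    case 3
    from id[OF this(2)] 3(1) show ?thesis by (intro bexI[of _ "T4 w"]) (auto simp: brace_list_def)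
  next
    case 4
    from neg[OF this] 4(1) show ?thesis by (intro bexI[of _ "T4 w"]) (auto simp: brace_list_def)
  qed
qed

text \<open>The circle group is cyclic with generator \<open>(0, 1)\<close>, whose circle powers run
  through \<open>(1, 0)\<close>, \<open>(1, 1)\<close> and \<open>(0, 0)\<close>.\<close>

lemma extension_nontrivial_brace_22_label:
  assumes q: "prime q" "q > 3" and w: "4 dvd q - 1 \<Longrightarrow> [w ^ 2 = - 1] (mod int q)"
    and chi: "brace_character nontrivial_brace_22 chi q"
  shows "\<exists>l \<in> brace_list q w. isomorphic_to_label q (brace_extension nontrivial_brace_22 chi q) l"
proof -
  define t where "t = chi (0, 1)"
  note mult = character_closed[OF chi]
  have 0: "[chi (0, 0) = t ^ 0] (mod int q)" using character_zero[OF chi] by simp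
  have 1: "[chi (0, 1) = t ^ 1] (mod int q)" by (simp add: t_def)
  have 2: "[chi (1, 0) = t ^ 2] (mod int q)"
    using cong_power_Suc[OF mult[of "(0, 1)" "(0, 1)" "(1, 0)", folded t_def] 1[folded t_def]]
    by (simp add: numeral_eq_Suc)
  have 3: "[chi (1, 1) = t ^ 3] (mod int q)"
    using cong_power_Suc[OF mult[of "(0, 1)" "(1, 0)" "(1, 1)", folded t_def] 2]
    by (simp add: numeral_eq_Suc)
  have "[chi (0, 0) = t ^ 4] (mod int q)"
    using cong_power_Suc[OF mult[of "(0, 1)" "(1, 1)" "(0, 0)", folded t_def] 3]
    by (simp add: numeral_eq_Suc)
  then have t4: "[t ^ 4 = 1] (mod int q)"
    using cong_trans[OF cong_sym 0] by simp
  have chi_pow: "[chi (x, y) = t ^ nat (2 * x + y)] (mod int q)"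
    if "(x, y) \<in> {(0, 0), (0, 1), (1, 0), (1, 1)}" for x y
    using that 0 1 2 3 by auto
  have id: "brace_isomorphic (brace_extension nontrivial_brace_22 chi q) (brace_B22 q v)"
    if "[t = v] (mod int q)" for v
    unfolding named_brace_eq_extension
  proof (rule brace_extension_isomorphic[where f = id])
    fix u assume u: "u \<in> carrier nontrivial_brace_22"
    obtain x y where xy: "u = (x, y)" by (cases u)
    have "[chi (x, y) = t ^ nat (2 * x + y)] (mod int q)" using u xy by (intro chi_pow) simp
    also have "[t ^ nat (2 * x + y) = v ^ nat (2 * x + y)] (mod int q)" by (rule cong_pow[OF that])
    finally show "[(case id u of (x, y) \<Rightarrow> v ^ nat (2 * x + y)) = chi u] (mod int q)"
      by (simp add: cong_sym xy)
  qed (auto simp: bij_betw_def)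
  have neg: "brace_isomorphic (brace_extension nontrivial_brace_22 chi q) (brace_B22 q w)"
    if "4 dvd q - 1" "[t = w ^ 3] (mod int q)"
    unfolding named_brace_eq_extension
  \<comment> \<open>This shear is circle inversion: it fixes \<open>(1, 0)\<close> and exchanges
    \<open>(0, 1)\<close> with its circle cube \<open>(1, 1)\<close>. It is additive and keeps
    \<open>y\<close>, on which the products depend.\<close>
  proof (rule brace_extension_isomorphic[where f = "\<lambda>(x, y). ((x + y) mod 2, y)"])
    have w4: "[w ^ 4 = 1] (mod int q)"
      using cong_pow[OF w[OF that(1)], of 2] by simp
    fix u assume u: "u \<in> carrier nontrivial_brace_22"
    obtain x y where xy: "u = (x, y)" by (cases u)
    have "[chi (x, y) = t ^ nat (2 * x + y)] (mod int q)" using u xy by (intro chi_pow) simp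
    also have "[t ^ nat (2 * x + y) = w ^ (3 * nat (2 * x + y))] (mod int q)"
      unfolding power_mult by (rule cong_pow[OF that(2)])
    also have "[w ^ (3 * nat (2 * x + y)) = w ^ nat (2 * ((x + y) mod 2) + y)] (mod int q)"
      by (rule cong_power_mod_4[OF w4]) (use u xy in auto)
    finally show "[(case case u of (x, y) \<Rightarrow> ((x + y) mod 2, y) of (x, y) \<Rightarrow> w ^ nat (2 * x + y)) = chi u] (mod int q)"
      by (simp add: cong_sym xy)
  qed (auto simp: bij_betw_def inj_on_def)
  from fourth_roots_mod_prime[OF q t4 w]
  consider "[t = 1] (mod int q)" | "[t = - 1] (mod int q)"
    | "4 dvd q - 1" "[t = w] (mod int q)" | "4 dvd q - 1" "[t = w ^ 3] (mod int q)"
    by blast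
  then show ?thesis
  proof cases
    case 1
    from id[OF this] show ?thesis by (intro bexI[of _ "B22 1"]) (auto simp: brace_list_def)
  next
    case 2
    from id[OF this] show ?thesis by (intro bexI[of _ "B22 (- 1)"]) (auto simp: brace_list_def)
  next
    case 3
    from id[OF this(2)] 3(1) show ?thesis by (intro bexI[of _ "B22 w"]) (auto simp: brace_list_def)
  next
    case 4
    from neg[OF this] 4(1) show ?thesis by (intro bexI[of _ "B22 w"]) (auto simp: brace_list_def)
  qed
qed

text \<open>Every additive automorphism preserves the zero multiplication. These automorphisms
  permute the three nontrivial characters transitively; a swap and a shear suffice to reach the sign
  pair \<open>(- 1, 1)\<close>.\<close>

lemma extension_trivial_brace_22_label:
  assumes q: "prime q" and chi: "brace_character trivial_brace_22 chi q"
  shows "\<exists>l \<in> brace_list q w. isomorphic_to_label q (brace_extension trivial_brace_22 chi q) l"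
proof -
  note mult = character_closed[OF chi]
  have 0: "[chi (0, 0) = 1] (mod int q)" using character_zero[OF chi] by simp
  have "[chi (1, 0) * chi (1, 0) = 1] (mod int q)" "[chi (0, 1) * chi (0, 1) = 1] (mod int q)"
    using cong_trans[OF cong_sym[OF mult[of "(1, 0)" "(1, 0)" "(0, 0)"]] 0]
      cong_trans[OF cong_sym[OF mult[of "(0, 1)" "(0, 1)" "(0, 0)"]] 0] by simp_all
  then obtain r s where rs: "r \<in> {1, - 1}" "s \<in> {1, - 1}"
    "[chi (1, 0) = r] (mod int q)" "[chi (0, 1) = s] (mod int q)"
    using cong_square_eq_1[OF q] by (metis insertCI)
  have "[chi (1, 1) = chi (1, 0) * chi (0, 1)] (mod int q)" by (rule mult) auto
  also have "[chi (1, 0) * chi (0, 1) = r * s] (mod int q)" by (intro cong_mult rs)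
  finally have chi': "\<forall>u \<in> carrier trivial_brace_22. [(\<lambda>(x, y). r ^ nat x * s ^ nat y) u = chi u] (mod int q)"
    using 0 rs by (simp add: cong_sym)
  have iso: "brace_isomorphic (brace_extension trivial_brace_22 chi q) (brace_T22 q v 1)"
    if f: "bij_betw f (carrier trivial_brace_22) (carrier trivial_brace_22)"
      "\<And>x y. \<lbrakk>x \<in> carrier trivial_brace_22; y \<in> carrier trivial_brace_22\<rbrakk>
        \<Longrightarrow> f (x \<oplus>\<^bsub>trivial_brace_22\<^esub> y) = f x \<oplus>\<^bsub>trivial_brace_22\<^esub> f y"
      "f (0, 0) = (0, 0)"
      "\<forall>u \<in> carrier trivial_brace_22. (\<lambda>(x, y). v ^ nat x * 1 ^ nat y) (f u) = (\<lambda>(x, y). r ^ nat x * s ^ nat y) u"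
    for f v
    unfolding named_brace_eq_extension
  proof (rule brace_extension_isomorphic[OF f(1,2)])
    fix u assume u: "u \<in> carrier trivial_brace_22"
    show "[(\<lambda>(x, y). v ^ nat x * 1 ^ nat y) (f u) = chi u] (mod int q)"
      unfolding f(4)[rule_format, OF u] by (rule chi'[rule_format, OF u])
  qed (simp_all add: f(3))
  consider "r = 1" "s = 1" | "r = - 1" "s = 1" | "r = 1" "s = - 1" | "r = - 1" "s = - 1"
    using rs by auto
  then show ?thesis
  proof cases
    case 1
    then show ?thesis
      using iso[of id 1] by (intro bexI[of _ "T22 1 1"]) (simp_all add: brace_list_def)
  next
    case 2
    then show ?thesis
      using iso[of id "- 1"] by (intro bexI[of _ "T22 (- 1) 1"]) (simp_all add: brace_list_def)
  next
    case 3
    have "brace_isomorphic (brace_extension trivial_brace_22 chi q) (brace_T22 q (- 1) 1)"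
      by (rule iso[of "\<lambda>(x, y). (y, x)"]) (use 3 in \<open>auto simp: bij_betw_def inj_on_def\<close>)
    then show ?thesis
      by (intro bexI[of _ "T22 (- 1) 1"]) (simp_all add: brace_list_def)
  next
    case 4
    have "brace_isomorphic (brace_extension trivial_brace_22 chi q) (brace_T22 q (- 1) 1)"
      by (rule iso[of "\<lambda>(x, y). ((x + y) mod 2, y)"]) (use 4 in \<open>auto simp: bij_betw_def inj_on_def\<close>)
    then show ?thesis
      by (intro bexI[of _ "T22 (- 1) 1"]) (simp_all add: brace_list_def)
  qed
qed

text \<open>Negation is the only nontrivial additive automorphism. It fixes 2 and exchanges 1 with
  3, so it keeps \<open>r\<close> and replaces \<open>s\<close> by \<open>r * s\<close>: the pair
  \<open>(- 1, - 1)\<close> merges with \<open>(- 1, 1)\<close>, while \<open>(1, - 1)\<close> stays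
  apart.\<close>

lemma extension_nontrivial_brace_4_label:
  assumes q: "prime q" and chi: "brace_character nontrivial_brace_4 chi q"
  shows "\<exists>l \<in> brace_list q w. isomorphic_to_label q (brace_extension nontrivial_brace_4 chi q) l"
proof -
  note mult = character_closed[OF chi]
  have 0: "[chi 0 = 1] (mod int q)" using character_zero[OF chi] by simp
  have "[chi 2 * chi 2 = 1] (mod int q)" "[chi 1 * chi 1 = 1] (mod int q)"
    using cong_trans[OF cong_sym[OF mult[of 2 2 0]] 0]
      cong_trans[OF cong_sym[OF mult[of 1 1 0]] 0] by simp_all
  then obtain r s where rs: "r \<in> {1, - 1}" "s \<in> {1, - 1}"
    "[chi 2 = r] (mod int q)" "[chi 1 = s] (mod int q)"
    using cong_square_eq_1[OF q] by (metis insertCI)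
  have "[chi 3 = chi 2 * chi 1] (mod int q)" by (rule mult) auto
  also have "[chi 2 * chi 1 = r * s] (mod int q)" by (intro cong_mult rs)
  finally have chi': "\<forall>u \<in> carrier nontrivial_brace_4. [r ^ nat (u div 2) * s ^ nat (u mod 2) = chi u] (mod int q)"
    using 0 rs by (simp add: cong_sym)
  have iso: "brace_isomorphic (brace_extension nontrivial_brace_4 chi q) (brace_B4 q v m)"
    if f: "bij_betw f (carrier nontrivial_brace_4) (carrier nontrivial_brace_4)"
      "\<And>x y. \<lbrakk>x \<in> carrier nontrivial_brace_4; y \<in> carrier nontrivial_brace_4\<rbrakk>
        \<Longrightarrow> f (x \<oplus>\<^bsub>nontrivial_brace_4\<^esub> y) = f x \<oplus>\<^bsub>nontrivial_brace_4\<^esub> f y"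
      "\<And>x y. \<lbrakk>x \<in> carrier nontrivial_brace_4; y \<in> carrier nontrivial_brace_4\<rbrakk>
        \<Longrightarrow> f (x \<otimes>\<^bsub>nontrivial_brace_4\<^esub> y) = f x \<otimes>\<^bsub>nontrivial_brace_4\<^esub> f y"
      "\<forall>u \<in> carrier nontrivial_brace_4. v ^ nat (f u div 2) * m ^ nat (f u mod 2)
        = r ^ nat (u div 2) * s ^ nat (u mod 2)"
    for f v m
    unfolding named_brace_eq_extension
  proof (rule brace_extension_isomorphic[OF f(1-3)])
    fix u assume u: "u \<in> carrier nontrivial_brace_4"
    show "[v ^ nat (f u div 2) * m ^ nat (f u mod 2) = chi u] (mod int q)"
      unfolding f(4)[rule_format, OF u] by (rule chi'[rule_format, OF u])
  qed
  consider "r = - 1" "s = - 1" | "(r, s) \<in> {(1, 1), (1, - 1), (- 1, 1)}"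
    using rs by auto
  then show ?thesis
  proof cases
    case 1
    have "brace_isomorphic (brace_extension nontrivial_brace_4 chi q) (brace_B4 q (- 1) 1)"
      by (rule iso[of "\<lambda>u. (- u) mod 4"]) (use 1 in \<open>auto simp: bij_betw_def inj_on_def\<close>)
    then show ?thesis
      by (intro bexI[of _ "B4 (- 1) 1"]) (simp_all add: brace_list_def)
  next
    case 2
    then show ?thesis
      using iso[of id r s] by (intro bexI[of _ "B4 r s"]) (auto simp: brace_list_def)
  qed
qed

section \<open>Existence and uniqueness of the label\<close>

lemma isomorphic_to_label_trans:
  "\<lbrakk>brace_isomorphic A B; isomorphic_to_label q B l\<rbrakk> \<Longrightarrow> isomorphic_to_label q A l"
  by (cases l) (auto intro: brace_isomorphic_trans)

lemma isomorphic_to_some_label: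
  assumes A: "left_brace A" "order A = 4 * q"
    and q: "prime q" "q > 3" and w: "4 dvd q - 1 \<Longrightarrow> [w ^ 2 = - 1] (mod int q)"
  shows "\<exists>l \<in> brace_list q w. isomorphic_to_label q A l"
proof -
  interpret left_brace A by fact
  obtain P chi where P: "left_brace (A\<lparr>carrier := P\<rparr>)" "card P = 4"
    "brace_character (A\<lparr>carrier := P\<rparr>) chi q"
    "brace_isomorphic (brace_extension (A\<lparr>carrier := P\<rparr>) chi q) A"
    by (rule isomorphic_extension_of_order_4[OF q A(2)])
  let ?P = "A\<lparr>carrier := P\<rparr>"
  \<comment> \<open>Polymorphic in the carrier of \<open>K\<close>, because the models live over
    both \<open>int\<close> and \<open>int \<times> int\<close>.\<close>
  have ext: "\<exists>l \<in> brace_list q w. isomorphic_to_label q A l"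
    if iso: "brace_isomorphic ?P K" and K: "left_brace K"
      and "\<And>chi. brace_character K chi q
        \<Longrightarrow> \<exists>l \<in> brace_list q w. isomorphic_to_label q (brace_extension K chi q) l"
    for K :: "'c ring"
  proof -
    obtain chi' where chi': "brace_character K chi' q"
      "brace_isomorphic (brace_extension K chi' q) (brace_extension ?P chi q)"
      by (rule character_transport[OF P(1) K iso P(3)])
    have "brace_isomorphic (brace_extension K chi' q) A"
      by (rule brace_isomorphic_trans[OF chi'(2) P(4)])
    then have "brace_isomorphic A (brace_extension K chi' q)"
      using brace_isomorphic_sym[OF left_brace_extension[OF K chi'(1)]] q(2) by simp
    then show ?thesis using that(3)[OF chi'(1)] isomorphic_to_label_trans[of A] by blast
  qed
  have order_P: "order ?P = 4" using P(2) by (simp add: order_def)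
  show ?thesis
  proof (cases "\<forall>x \<in> P. x \<oplus>\<^bsub>A\<^esub> x = \<zero>\<^bsub>A\<^esub>")
    case True
    then have "brace_isomorphic ?P trivial_brace_22 \<or> brace_isomorphic ?P nontrivial_brace_22"
      by (intro left_brace.isomorphic_elementary_order_4[OF P(1) order_P]) simp
    then show ?thesis
      using ext left_brace_order_4 extension_trivial_brace_22_label[OF q(1)]
        extension_nontrivial_brace_22_label[OF q w] by blast
  next
    case False
    then obtain x where "x \<in> P" "x \<oplus>\<^bsub>A\<^esub> x \<noteq> \<zero>\<^bsub>A\<^esub>" by blast
    then have "brace_isomorphic ?P trivial_brace_4 \<or> brace_isomorphic ?P nontrivial_brace_4"
      by (intro left_brace.isomorphic_cyclic_order_4[OF P(1) order_P, of x]) simp_all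
    then show ?thesis
      using ext left_brace_order_4 extension_trivial_brace_4_label[OF q w]
        extension_nontrivial_brace_4_label[OF q(1)] by blast
  qed
qed

lemma label_signature_isomorphic_labels:
  assumes l: "labels_brace_of_order n q l" and l': "labels_brace_of_order n q l'"
    and iso: "isomorphic_labels q l l'"
  shows "label_signature q l = label_signature q l'"
proof (cases l)
  case (T22 w m)
  then show ?thesis using label_signature_eq[OF _ l', of "brace_T22 q w m"] l iso by simp
next
  case (T4 w)
  then show ?thesis using label_signature_eq[OF _ l', of "brace_T4 q w"] l iso by simp
next
  case (B22 w)
  then show ?thesis using label_signature_eq[OF _ l', of "brace_B22 q w"] l iso by simp
next
  case (B4 w m)
  then show ?thesis using label_signature_eq[OF _ l', of "brace_B4 q w m"] l iso by simp
qed

theorem theorem6: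
  fixes q :: nat and w :: int
  assumes "prime q" and "q > 3"
    and "4 dvd q - 1 \<Longrightarrow> primitive_fourth_root_mod q w"
  shows "(\<forall>l \<in> brace_list q w. labels_brace_of_order (4 * q) q l) \<and>
         (\<forall>l \<in> brace_list q w. \<forall>l' \<in> brace_list q w. l \<noteq> l' \<longrightarrow> \<not> isomorphic_labels q l l') \<and>
         (\<forall>A :: ('a, 'm) ring_scheme. left_brace A \<and> order A = 4 * q \<longrightarrow>
            (\<exists>!l. l \<in> brace_list q w \<and> isomorphic_to_label q A l))"
proof -
  have w2: "4 dvd q - 1 \<Longrightarrow> [w ^ 2 = - 1] (mod int q)"
    using primitive_fourth_root_square[OF assms(1,2)] assms(3) by blast
  then have w4: "4 dvd q - 1 \<Longrightarrow> [w ^ 4 = 1] (mod int q)"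
    using cong_pow[of "w ^ 2" "- 1" "int q" 2] by simp
  have brace: "labels_brace_of_order (4 * q) q l" if "l \<in> brace_list q w" for l
    using brace_list_brace_of_order[OF _ w4 that] assms(2) by simp
  have inj: "inj_on (label_signature q) (brace_list q w)"
    using inj_on_label_signature[OF _ _ w2] prime_odd_nat[OF assms(1)] assms(2) by simp
  have "l = l'"
    if l: "l \<in> brace_list q w" "l' \<in> brace_list q w" and "isomorphic_labels q l l'" for l l'
    using inj_onD[OF inj label_signature_isomorphic_labels[OF brace[OF l(1)] brace[OF l(2)] that(3)] l] .
  moreover have "\<exists>!l. l \<in> brace_list q w \<and> isomorphic_to_label q A l"
    if A: "left_brace A" "order A = 4 * q" for A :: "('a, 'm) ring_scheme"
  proof -
    \<comment> \<open>Both labels share the signature of \<open>A\<close>, so no isomorphism between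
      the labelled braces has to be composed.\<close>
    have "l = l'"
      if "l \<in> brace_list q w" "isomorphic_to_label q A l"
        "l' \<in> brace_list q w" "isomorphic_to_label q A l'" for l l'
      using inj_onD[OF inj _ that(1,3)] label_signature_eq[OF A(1) brace] that by metis
    then show ?thesis
      using isomorphic_to_some_label[OF A assms(1,2) w2] by blast
  qed
  ultimately show ?thesis using brace by blast
qed

end
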